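(* Let $\tau_t(n)$ denote the maximum number of rainbow $t$-cliques in an almost $t$-Gallai colouring of $E(K_n)$. Then: (i) for every fixed $t \ge 3$, $\tau_t(n) = o(n^2)$ as $n \to \infty$; (ii) for every fixed $t \ge 4$, $\tau_t(n) \ge n^{2-o(1)}$ as $n \to \infty$. Moreover, the lower bound in (ii) is attained by almost $t$-Gallai colourings of $E(K_n)$ that use only $\binom{t}{2}$ colours.
   Context: For an integer $t \ge 3$, a colouring $c : E(K_n) \to \mathbb{N}$ of the edges of the complete graph $K_n$ is called almost $t$-Gallai if no two rainbow $t$-cliques share an edge, where a $t$-clique is rainbow if its $\binom{t}{2}$ edges receive pairwise distinct colours. *)

theory Defs
  imports Complex_Main
begin

text \<open>Vertices of K_n are 0..n-1; edges are 2-element subsets; a colouring is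
 any function from edges (sets of vertices) to nat (values off edges are irrelevant).\<close>

definition edges_of :: "nat set \<Rightarrow> nat set set" where
  "edges_of S = {e. e \<subseteq> S \<and> card e = 2}"

definition Kn_edges :: "nat \<Rightarrow> nat set set" where
  "Kn_edges n = edges_of {..<n}"

definition rainbow_clique :: "nat \<Rightarrow> nat \<Rightarrow> (nat set \<Rightarrow> nat) \<Rightarrow> nat set \<Rightarrow> bool" where
  "rainbow_clique t n c S \<longleftrightarrow> S \<subseteq> {..<n} \<and> card S = t \<and> inj_on c (edges_of S)"

definition rainbow_cliques :: "nat \<Rightarrow> nat \<Rightarrow> (nat set \<Rightarrow> nat) \<Rightarrow> nat set set" where
  "rainbow_cliques t n c = {S. rainbow_clique t n c S}"

definition almost_gallai :: "nat \<Rightarrow> nat \<Rightarrow> (nat set \<Rightarrow> nat) \<Rightarrow> bool" where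
  "almost_gallai t n c \<longleftrightarrow>
     (\<forall>S T. rainbow_clique t n c S \<and> rainbow_clique t n c T \<and> S \<noteq> T \<longrightarrow>
        \<not> (\<exists>e. e \<in> edges_of S \<and> e \<in> edges_of T))"

definition tau :: "nat \<Rightarrow> nat \<Rightarrow> nat" where
  "tau t n = Max {k. \<exists>c. almost_gallai t n c \<and> card (rainbow_cliques t n c) = k}"

end

theory Submission
  imports Defs "HOL-Library.FuncSet" "HOL-Library.Nat_Bijection"
begin

text \<open>
  Upper bound: a random map from colours to index pairs \<open>(i, j)\<close> with \<open>i < j < t\<close> keeps a positive
  proportion of the rainbow cliques aligned, meaning that the edge between the \<open>i\<close>th and \<open>j\<close>th vertex
  receives the label \<open>(i, j)\<close>. Every labelled tuple is then a rainbow clique. If there were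
  quadratically many aligned cliques, Szemeredi's regularity lemma would give \<open>t\<close> large clusters that
  are pairwise regular and dense for the matching labels; greedy embedding into them yields two
  labelled tuples that differ only in the last vertex, hence two rainbow cliques sharing an edge.

  Lower bound: take \<open>t\<close> classes of integers and the cliques \<open>{x + i y : i < t}\<close> with \<open>y\<close> in a
  Behrend-type set \<open>A\<close>. Colour their edges by the pair of classes and all other edges by the colour
  of the pair \<open>{2, 3}\<close>. With only \<open>t choose 2\<close> colours available, a rainbow clique uses each colour once,
  so all its edges except possibly the one between classes 2 and 3 come from the cliques above; as
  \<open>t \<ge> 4\<close>, the triangles on classes 0, 1, k and the equation-freeness of \<open>A\<close> force a single pair \<open>(x, y)\<close>.
\<close>

section \<open>Conditional averages over a partition and their energy\<close>

text \<open>Conditional expectation of \<open>f\<close> under the uniform measure on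
  \<open>X\<close>, given the partition of \<open>X\<close> into the fibres of
  \<open>\<phi>\<close>. With partitions coded by maps, refinement becomes a condition on equality
  of values.\<close>

definition fibre_avg :: "'a set \<Rightarrow> ('a \<Rightarrow> 'b) \<Rightarrow> ('a \<Rightarrow> real) \<Rightarrow> 'a \<Rightarrow> real" where
  "fibre_avg X \<phi> f x = (\<Sum>x' | x' \<in> X \<and> \<phi> x' = \<phi> x. f x') / real (card {x' \<in> X. \<phi> x' = \<phi> x})"

lemma fibre_avg_cong: "\<phi> x = \<phi> y \<Longrightarrow> fibre_avg X \<phi> f x = fibre_avg X \<phi> f y"
  by (simp add: fibre_avg_def)

text \<open>The pull-out property of conditional expectation: the weight \<open>g\<close> is
  constant on each fibre, and over a single fibre \<open>f\<close> and its average have the same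
  sum.\<close>

lemma sum_mult_fibre_avg:
  assumes "finite X" and g: "\<And>x y. x \<in> X \<Longrightarrow> y \<in> X \<Longrightarrow> \<phi> x = \<phi> y \<Longrightarrow> g x = g y"
  shows "(\<Sum>x\<in>X. g x * fibre_avg X \<phi> f x) = (\<Sum>x\<in>X. g x * f x)"
proof -
  have "(\<Sum>x | x \<in> X \<and> \<phi> x = a. g x * fibre_avg X \<phi> f x) = (\<Sum>x | x \<in> X \<and> \<phi> x = a. g x * f x)"
    (is "sum _ ?F = _") if "a \<in> \<phi> ` X" for a
  proof -
    from that obtain z where z: "z \<in> X" "\<phi> z = a" by auto
    have card: "card ?F \<noteq> 0" using z \<open>finite X\<close> by auto
    have "(\<Sum>x\<in>?F. g x * fibre_avg X \<phi> f x) = (\<Sum>x\<in>?F. g z * fibre_avg X \<phi> f z)"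
      by (intro sum.cong refl arg_cong2[where f = "(*)"] fibre_avg_cong g) (use z in auto)
    also have "\<dots> = g z * (\<Sum>x\<in>?F. f x)"
      using card z by (simp add: fibre_avg_def)
    also have "\<dots> = (\<Sum>x\<in>?F. g z * f x)" by (rule sum_distrib_left)
    also have "\<dots> = (\<Sum>x\<in>?F. g x * f x)"
      by (intro sum.cong arg_cong2[where f = "(*)"] refl g) (use z in auto)
    finally show ?thesis .
  qed
  then have "(\<Sum>a\<in>\<phi> ` X. \<Sum>x | x \<in> X \<and> \<phi> x = a. g x * fibre_avg X \<phi> f x)
      = (\<Sum>a\<in>\<phi> ` X. \<Sum>x | x \<in> X \<and> \<phi> x = a. g x * f x)"
    by (rule sum.cong[OF refl])
  then show ?thesis by (simp flip: sum.image_gen[OF \<open>finite X\<close>])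
qed

lemma fibre_avg_nonneg: "(\<And>x. x \<in> X \<Longrightarrow> 0 \<le> f x) \<Longrightarrow> 0 \<le> fibre_avg X \<phi> f x"
  unfolding fibre_avg_def by (intro divide_nonneg_nonneg sum_nonneg) simp_all

lemma fibre_avg_le_1:
  assumes "\<And>x. x \<in> X \<Longrightarrow> f x \<le> 1"
  shows "fibre_avg X \<phi> f x \<le> 1"
proof -
  have "(\<Sum>x' | x' \<in> X \<and> \<phi> x' = \<phi> x. f x') \<le> (\<Sum>x' | x' \<in> X \<and> \<phi> x' = \<phi> x. 1)"
    by (rule sum_mono) (use assms in auto)
  then show ?thesis by (auto simp: fibre_avg_def divide_le_eq_1)
qed

text \<open>The mean square density of the regularity method, left unnormalised, so that its natural
  bound is \<open>card X\<close> rather than 1.\<close>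

definition energy :: "'a set \<Rightarrow> ('a \<Rightarrow> 'b) \<Rightarrow> ('a \<Rightarrow> real) \<Rightarrow> real" where
  "energy X \<phi> f = (\<Sum>x\<in>X. (fibre_avg X \<phi> f x)\<^sup>2)"

lemma energy_le_card:
  assumes "\<And>x. x \<in> X \<Longrightarrow> 0 \<le> f x" "\<And>x. x \<in> X \<Longrightarrow> f x \<le> 1"
  shows "energy X \<phi> f \<le> real (card X)"
proof -
  have "energy X \<phi> f \<le> (\<Sum>x\<in>X. 1)"
    unfolding energy_def
    by (intro sum_mono power_le_one fibre_avg_nonneg fibre_avg_le_1 assms)
  then show ?thesis by simp
qed

text \<open>Pythagoras: the coarse average is the orthogonal projection of the fine one, since the
  inner products of \<open>?P\<close> with \<open>?Q\<close> and with itself both equal that of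
  \<open>?P\<close> with \<open>f\<close>.\<close>

lemma energy_refine:
  assumes "finite X" and ref: "\<And>x y. x \<in> X \<Longrightarrow> y \<in> X \<Longrightarrow> \<psi> x = \<psi> y \<Longrightarrow> \<phi> x = \<phi> y"
  shows "(\<Sum>x\<in>X. (fibre_avg X \<psi> f x - fibre_avg X \<phi> f x)\<^sup>2) = energy X \<psi> f - energy X \<phi> f"
proof -
  let ?P = "fibre_avg X \<phi> f" and ?Q = "fibre_avg X \<psi> f"
  have "(\<Sum>x\<in>X. ?P x * ?Q x) = (\<Sum>x\<in>X. ?P x * f x)"
    by (rule sum_mult_fibre_avg[OF \<open>finite X\<close>]) (blast intro: fibre_avg_cong ref)
  moreover have "(\<Sum>x\<in>X. ?P x * ?P x) = (\<Sum>x\<in>X. ?P x * f x)"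
    by (rule sum_mult_fibre_avg[OF \<open>finite X\<close>]) (blast intro: fibre_avg_cong)
  moreover have "(\<Sum>x\<in>X. (?Q x - ?P x)\<^sup>2)
      = (\<Sum>x\<in>X. (?Q x)\<^sup>2) + (\<Sum>x\<in>X. ?P x * ?P x) - 2 * (\<Sum>x\<in>X. ?P x * ?Q x)"
    by (simp add: power2_diff sum.distrib sum_subtractf sum_distrib_left power2_eq_square algebra_simps)
  ultimately show ?thesis by (simp add: energy_def power2_eq_square)
qed

section \<open>A one-sided regularity lemma\<close>

definition density :: "('a \<times> 'b) set \<Rightarrow> 'a set \<Rightarrow> 'b set \<Rightarrow> real" where
  "density E A B = real (card (E \<inter> A \<times> B)) / (real (card A) * real (card B))"

text \<open>Greedy embedding only needs lower bounds on densities of large subpairs.\<close>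

definition lower_regular :: "real \<Rightarrow> ('a \<times> 'b) set \<Rightarrow> 'a set \<Rightarrow> 'b set \<Rightarrow> bool" where
  "lower_regular \<epsilon> E A B \<longleftrightarrow> (\<forall>A' B'. A' \<subseteq> A \<and> B' \<subseteq> B \<and>
     \<epsilon> * real (card A) \<le> real (card A') \<and> \<epsilon> * real (card B) \<le> real (card B') \<longrightarrow>
     (density E A B - \<epsilon>) * (real (card A') * real (card B')) \<le> real (card (E \<inter> A' \<times> B')))"

text \<open>
  A partition of \<open>V\<close> is given by a family \<open>\<S>\<close> of sets, its parts being the atoms of \<open>\<S>\<close>; refining the
  partition then just means enlarging the family.
\<close>

definition trace :: "'a set set \<Rightarrow> 'a \<Rightarrow> 'a set set" where
  "trace \<S> x = {S \<in> \<S>. x \<in> S}"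

definition atom :: "'a set \<Rightarrow> 'a set set \<Rightarrow> 'a set set \<Rightarrow> 'a set" where
  "atom V \<S> a = {x \<in> V. trace \<S> x = a}"

lemma trace_in_Pow: "trace \<S> x \<in> Pow \<S>"
  by (auto simp: trace_def)

lemma trace_mono:
  assumes "\<S> \<subseteq> \<T>" "trace \<T> x = trace \<T> y"
  shows "trace \<S> x = trace \<S> y"
proof -
  have "trace \<S> z = trace \<T> z \<inter> \<S>" for z using assms(1) by (auto simp: trace_def)
  then show ?thesis using assms(2) by simp
qed

lemma trace_prod_mono:
  assumes "\<S> \<subseteq> \<T>" "map_prod (trace \<T>) (trace \<T>) p = map_prod (trace \<T>) (trace \<T>) q"
  shows "map_prod (trace \<S>) (trace \<S>) p = map_prod (trace \<S>) (trace \<S>) q"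
  using assms trace_mono[OF assms(1), of "fst p" "fst q"] trace_mono[OF assms(1), of "snd p" "snd q"]
  by (simp add: prod_eq_iff)

text \<open>The fibres of the pair of traces are products of two atoms. Energy thus becomes the
  usual sum of squared densities over pairs of parts, weighted by their size.\<close>

lemma fibre_avg_trace:
  assumes "finite V"
  shows "fibre_avg (V \<times> V) (map_prod (trace \<S>) (trace \<S>)) (\<lambda>p. of_bool (p \<in> E)) (x, y)
     = density E (atom V \<S> (trace \<S> x)) (atom V \<S> (trace \<S> y))"
proof -
  let ?A = "atom V \<S> (trace \<S> x)" and ?B = "atom V \<S> (trace \<S> y)"
  have "{p \<in> V \<times> V. map_prod (trace \<S>) (trace \<S>) p = map_prod (trace \<S>) (trace \<S>) (x, y)} = ?A \<times> ?B"
    by (auto simp: atom_def)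
  moreover have "finite ?A" "finite ?B" using assms by (auto simp: atom_def)
  ultimately show ?thesis
    by (simp add: fibre_avg_def density_def card_cartesian_product of_bool_def sum.If_cases Int_commute)
qed

text \<open>Witnesses of irregularity are added to the family. On a witness rectangle the fine
  average lies at least \<epsilon> below the coarse one in the mean, so the squared difference sums
  to \<open>\<epsilon>^2\<close> times its area, hence to \<open>\<epsilon>^4\<close> times the area
  of the atom pair. Irregular pairs cover more than an \<epsilon>-fraction of
  \<open>V \<times> V\<close>, whence \<open>\<epsilon>^5\<close>.\<close>

lemma energy_increment_step:
  fixes E :: "('a \<times> 'a) set"
  assumes V: "finite V" and \<S>: "finite \<S>" and \<epsilon>: "0 < \<epsilon>"
    and irr: "\<epsilon> * (real (card V))\<^sup>2 <
      real (card {(x, y) \<in> V \<times> V. \<not> lower_regular \<epsilon> E (atom V \<S> (trace \<S> x)) (atom V \<S> (trace \<S> y))})"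
  obtains \<T> where "finite \<T>" "\<S> \<subseteq> \<T>" "card \<T> \<le> card \<S> + 2 * 4 ^ card \<S>"
    "energy (V \<times> V) (map_prod (trace \<S>) (trace \<S>)) (\<lambda>p. of_bool (p \<in> E)) + \<epsilon> ^ 5 * (real (card V))\<^sup>2
      \<le> energy (V \<times> V) (map_prod (trace \<T>) (trace \<T>)) (\<lambda>p. of_bool (p \<in> E))"
proof -
  define cl where "cl = atom V \<S>"
  define Ir where "Ir = {(a, b) \<in> Pow \<S> \<times> Pow \<S>. \<not> lower_regular \<epsilon> E (cl a) (cl b)}"
  have "\<forall>p\<in>Ir. \<exists>W. fst W \<subseteq> cl (fst p) \<and> snd W \<subseteq> cl (snd p) \<and>
     \<epsilon> * real (card (cl (fst p))) \<le> real (card (fst W)) \<and> \<epsilon> * real (card (cl (snd p))) \<le> real (card (snd W)) \<and>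
     real (card (E \<inter> fst W \<times> snd W)) < (density E (cl (fst p)) (cl (snd p)) - \<epsilon>) * (real (card (fst W)) * real (card (snd W)))"
    (is "\<forall>p\<in>Ir. ?W p")
  proof
    fix p assume "p \<in> Ir"
    then have "\<not> lower_regular \<epsilon> E (cl (fst p)) (cl (snd p))" by (auto simp: Ir_def)
    then obtain A B where "A \<subseteq> cl (fst p)" "B \<subseteq> cl (snd p)"
      "\<epsilon> * real (card (cl (fst p))) \<le> real (card A)" "\<epsilon> * real (card (cl (snd p))) \<le> real (card B)"
      "real (card (E \<inter> A \<times> B)) < (density E (cl (fst p)) (cl (snd p)) - \<epsilon>) * (real (card A) * real (card B))"
      unfolding lower_regular_def by (meson not_le)
    then show "?W p" by (intro exI[of _ "(A, B)"]) simp
  qed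
  from bchoice[OF this] obtain W where W: "\<And>p. p \<in> Ir \<Longrightarrow> fst (W p) \<subseteq> cl (fst p) \<and> snd (W p) \<subseteq> cl (snd p) \<and>
     \<epsilon> * real (card (cl (fst p))) \<le> real (card (fst (W p))) \<and> \<epsilon> * real (card (cl (snd p))) \<le> real (card (snd (W p))) \<and>
     real (card (E \<inter> fst (W p) \<times> snd (W p))) <
       (density E (cl (fst p)) (cl (snd p)) - \<epsilon>) * (real (card (fst (W p))) * real (card (snd (W p))))"
    by blast
  \<comment> \<open>At most two new sets for each of the at most \<open>4 ^ card \<S>\<close> pairs
    of traces.\<close>
  define \<T> where "\<T> = \<S> \<union> ((fst \<circ> W) ` Ir \<union> (snd \<circ> W) ` Ir)"
  have finIr: "finite Ir" using \<S> by (auto simp: Ir_def intro: finite_subset[of _ "Pow \<S> \<times> Pow \<S>"])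
  have "card Ir \<le> card (Pow \<S> \<times> Pow \<S>)"
    using \<S> by (intro card_mono) (auto simp: Ir_def)
  also have "\<dots> = 4 ^ card \<S>"
    using \<S> by (simp add: card_cartesian_product card_Pow flip: power_mult_distrib)
  finally have cardIr: "card Ir \<le> 4 ^ card \<S>" .
  have finT: "finite \<T>" using \<S> finIr by (simp add: \<T>_def)
  have "card \<T> \<le> card \<S> + (card ((fst \<circ> W) ` Ir) + card ((snd \<circ> W) ` Ir))"
    unfolding \<T>_def by (rule order.trans[OF card_Un_le add_left_mono[OF card_Un_le]])
  also have "\<dots> \<le> card \<S> + (card Ir + card Ir)"
    by (intro add_mono card_image_le finIr order_refl)
  finally have cardT: "card \<T> \<le> card \<S> + 2 * 4 ^ card \<S>" using cardIr by simp
  define f :: "'a \<times> 'a \<Rightarrow> real" where "f = (\<lambda>p. of_bool (p \<in> E))"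
  define X where "X = V \<times> V"
  define \<phi> where "\<phi> = map_prod (trace \<S>) (trace \<S>)"
  define \<psi> where "\<psi> = map_prod (trace \<T>) (trace \<T>)"
  define h where "h = (\<lambda>x. fibre_avg X \<psi> f x - fibre_avg X \<phi> f x)"
  have finX: "finite X" using V by (simp add: X_def)
  have ST: "\<S> \<subseteq> \<T>" by (simp add: \<T>_def)
  have ref: "\<phi> x = \<phi> y" if "\<psi> x = \<psi> y" for x y
    using that unfolding \<phi>_def \<psi>_def by (rule trace_prod_mono[OF ST])
  have gain: "\<epsilon> ^ 4 * (real (card (cl (fst p))) * real (card (cl (snd p)))) \<le> (\<Sum>x\<in>fst (W p) \<times> snd (W p). (h x)\<^sup>2)"
    if p: "p \<in> Ir" for p
  proof -
    obtain A B where AB: "W p = (A, B)" by force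
    define a b where "a = cl (fst p)" and "b = cl (snd p)"
    have w: "A \<subseteq> a" "B \<subseteq> b" "\<epsilon> * real (card a) \<le> real (card A)" "\<epsilon> * real (card b) \<le> real (card B)"
      "real (card (E \<inter> A \<times> B)) < (density E a b - \<epsilon>) * (real (card A) * real (card B))"
      using W[OF p] AB by (auto simp: a_def b_def)
    have fin: "finite A" "finite B" "A \<subseteq> V" "B \<subseteq> V"
      using w V by (auto simp: a_def b_def cl_def atom_def intro: finite_subset)
    have AT: "A \<in> \<T>" "B \<in> \<T>" using p AB by (auto simp: \<T>_def intro!: image_eqI[of _ _ p])
    have sub: "A \<times> B \<subseteq> X" using fin by (auto simp: X_def)
    \<comment> \<open>As \<open>A\<close> and \<open>B\<close> belong to \<open>\<T>\<close>, the
      rectangle is a union of fibres of \<open>\<psi>\<close>, so its indicator may serve as the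
      weight in \<open>sum_mult_fibre_avg\<close>.\<close>
    have meas: "(x \<in> A \<times> B) = (y \<in> A \<times> B)" if "\<psi> x = \<psi> y" for x y
    proof (cases x; cases y)
      fix x1 x2 y1 y2 assume xy: "x = (x1, x2)" "y = (y1, y2)"
      then have "trace \<T> x1 = trace \<T> y1" "trace \<T> x2 = trace \<T> y2" using that by (auto simp: \<psi>_def)
      then have "A \<in> trace \<T> x1 \<longleftrightarrow> A \<in> trace \<T> y1" "B \<in> trace \<T> x2 \<longleftrightarrow> B \<in> trace \<T> y2" by auto
      then show ?thesis using AT xy by (auto simp: trace_def)
    qed
    have restr: "(\<Sum>x\<in>X. of_bool (x \<in> A \<times> B) * g x) = (\<Sum>x\<in>A \<times> B. g x)" for g :: "_ \<Rightarrow> real"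
      by (rule sum.mono_neutral_cong_right[OF finX sub]) auto
    have 1: "(\<Sum>x\<in>A \<times> B. fibre_avg X \<psi> f x) = (\<Sum>x\<in>A \<times> B. f x)"
      unfolding restr[symmetric] by (intro sum_mult_fibre_avg[OF finX] arg_cong[where f = of_bool] meas)
    have 2: "(\<Sum>x\<in>A \<times> B. f x) = real (card (E \<inter> A \<times> B))"
      using fin by (simp add: f_def of_bool_def sum.If_cases Int_commute)
    have "fibre_avg X \<phi> f x = density E a b" if "x \<in> A \<times> B" for x
    proof (cases x)
      case (Pair x1 x2)
      then have "x1 \<in> a" "x2 \<in> b" using that w by auto
      then have "trace \<S> x1 = fst p" "trace \<S> x2 = snd p" by (auto simp: a_def b_def cl_def atom_def)
      then show ?thesis
        unfolding X_def \<phi>_def f_def Pair fibre_avg_trace[OF V] by (simp add: a_def b_def cl_def)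
    qed
    then have 3: "(\<Sum>x\<in>A \<times> B. fibre_avg X \<phi> f x) = density E a b * (real (card A) * real (card B))"
      by (simp add: card_cartesian_product)
    have "(\<Sum>x\<in>A \<times> B. h x) \<le> - \<epsilon> * (real (card A) * real (card B))"
      unfolding h_def sum_subtractf 1 2 3 using w(5) by (simp add: algebra_simps)
    then have "\<epsilon> * (\<epsilon> * (real (card A) * real (card B))) \<le> \<epsilon> * - (\<Sum>x\<in>A \<times> B. h x)"
      using \<epsilon> by (intro mult_left_mono) auto
    then have "\<epsilon>\<^sup>2 * (real (card A) * real (card B)) \<le> (\<Sum>x\<in>A \<times> B. - 2 * \<epsilon> * h x - \<epsilon>\<^sup>2)"
      by (simp add: sum_subtractf card_cartesian_product sum_negf power2_eq_square flip: sum_distrib_left)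
    \<comment> \<open>expanding \<open>(h x + \<epsilon>)\<^sup>2 \<ge> 0\<close> takes the place of Cauchy--Schwarz\<close>
    also have "\<dots> \<le> (\<Sum>x\<in>A \<times> B. (h x)\<^sup>2)"
    proof (rule sum_mono)
      fix x show "- 2 * \<epsilon> * h x - \<epsilon>\<^sup>2 \<le> (h x)\<^sup>2"
        using zero_le_power2[of "h x + \<epsilon>"] by (simp add: power2_sum algebra_simps)
    qed
    finally have 4: "\<epsilon>\<^sup>2 * (real (card A) * real (card B)) \<le> (\<Sum>x\<in>A \<times> B. (h x)\<^sup>2)" .
    have "(\<epsilon> * real (card a)) * (\<epsilon> * real (card b)) \<le> real (card A) * real (card B)"
      using w \<epsilon> by (intro mult_mono) auto
    then have "\<epsilon>\<^sup>2 * ((\<epsilon> * real (card a)) * (\<epsilon> * real (card b))) \<le> \<epsilon>\<^sup>2 * (real (card A) * real (card B))"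
      by (intro mult_left_mono) auto
    with 4 show ?thesis by (simp add: AB a_def b_def power2_eq_square power4_eq_xxxx mult_ac)
  qed
  define R where "R = {(x, y) \<in> V \<times> V. \<not> lower_regular \<epsilon> E (atom V \<S> (trace \<S> x)) (atom V \<S> (trace \<S> y))}"
  have "R \<subseteq> (\<Union>p\<in>Ir. cl (fst p) \<times> cl (snd p))"
  proof
    fix z assume "z \<in> R"
    then have "\<phi> z \<in> Ir" "z \<in> cl (fst (\<phi> z)) \<times> cl (snd (\<phi> z))"
      by (auto simp: R_def Ir_def \<phi>_def cl_def atom_def trace_def)
    then show "z \<in> (\<Union>p\<in>Ir. cl (fst p) \<times> cl (snd p))" by blast
  qed
  then have "card R \<le> card (\<Union>p\<in>Ir. cl (fst p) \<times> cl (snd p))"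
    using finIr V by (intro card_mono) (auto simp: cl_def atom_def)
  also have "\<dots> \<le> (\<Sum>p\<in>Ir. card (cl (fst p)) * card (cl (snd p)))"
    using card_UN_le[OF finIr, of "\<lambda>p. cl (fst p) \<times> cl (snd p)"] by (simp add: card_cartesian_product)
  finally have R: "real (card R) \<le> (\<Sum>p\<in>Ir. real (card (cl (fst p))) * real (card (cl (snd p))))"
    by (metis (mono_tags, lifting) of_nat_mono of_nat_sum of_nat_mult sum.cong)
  \<comment> \<open>Rectangles of different index pairs lie in disjoint products of atoms, so the
    gains add up.\<close>
  have disj: "(fst (W p) \<times> snd (W p)) \<inter> (fst (W q) \<times> snd (W q)) = {}" if "p \<in> Ir" "q \<in> Ir" "p \<noteq> q" for p q
  proof -
    have "fst p = fst q \<and> snd p = snd q" if "z \<in> fst (W p) \<times> snd (W p)" "z \<in> fst (W q) \<times> snd (W q)" for z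
    proof -
      have "fst z \<in> cl (fst p)" "fst z \<in> cl (fst q)" "snd z \<in> cl (snd p)" "snd z \<in> cl (snd q)"
        using that W[OF \<open>p \<in> Ir\<close>] W[OF \<open>q \<in> Ir\<close>] by auto
      then show ?thesis by (auto simp: cl_def atom_def)
    qed
    then show ?thesis using \<open>p \<noteq> q\<close> by (auto simp: prod_eq_iff)
  qed
  have subW: "fst (W p) \<times> snd (W p) \<subseteq> X" if "p \<in> Ir" for p
    using W[OF that] by (auto simp: X_def cl_def atom_def)
  have "\<epsilon> ^ 5 * (real (card V))\<^sup>2 = \<epsilon> ^ 4 * (\<epsilon> * (real (card V))\<^sup>2)"
    by (simp add: power_numeral_reduce)
  also have "\<dots> \<le> \<epsilon> ^ 4 * real (card R)"
    using irr \<epsilon> by (intro mult_left_mono) (auto simp: R_def)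
  also have "\<dots> \<le> \<epsilon> ^ 4 * (\<Sum>p\<in>Ir. real (card (cl (fst p))) * real (card (cl (snd p))))"
    using R \<epsilon> by (intro mult_left_mono) auto
  also have "\<dots> \<le> (\<Sum>p\<in>Ir. \<Sum>x\<in>fst (W p) \<times> snd (W p). (h x)\<^sup>2)"
    unfolding sum_distrib_left by (rule sum_mono) (rule gain)
  also have "\<dots> = (\<Sum>x\<in>(\<Union>p\<in>Ir. fst (W p) \<times> snd (W p)). (h x)\<^sup>2)"
    using finIr disj finite_subset[OF subW finX] by (intro sum.UNION_disjoint[symmetric]) auto
  also have "\<dots> \<le> (\<Sum>x\<in>X. (h x)\<^sup>2)"
    using subW by (intro sum_mono2 finX) auto
  also have "\<dots> = energy X \<psi> f - energy X \<phi> f"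
    unfolding h_def by (rule energy_refine[OF finX]) (rule ref)
  finally have "energy X \<phi> f + \<epsilon> ^ 5 * (real (card V))\<^sup>2 \<le> energy X \<psi> f" by simp
  then show thesis
    by (intro that[OF finT ST cardT]) (simp add: X_def \<phi>_def \<psi>_def f_def)
qed

text \<open>Ensures that a refinement made for one relation loses no energy for the others: the
  difference is a sum of squares.\<close>

lemma energy_mono_trace:
  assumes "finite V" "\<S> \<subseteq> \<T>"
  shows "energy (V \<times> V) (map_prod (trace \<S>) (trace \<S>)) f \<le> energy (V \<times> V) (map_prod (trace \<T>) (trace \<T>)) f"
proof -
  have "0 \<le> (\<Sum>x\<in>V \<times> V. (fibre_avg (V \<times> V) (map_prod (trace \<T>) (trace \<T>)) f x
      - fibre_avg (V \<times> V) (map_prod (trace \<S>) (trace \<S>)) f x)\<^sup>2)"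
    by (rule sum_nonneg) simp
  also have "\<dots> = energy (V \<times> V) (map_prod (trace \<T>) (trace \<T>)) f - energy (V \<times> V) (map_prod (trace \<S>) (trace \<S>)) f"
    using assms by (intro energy_refine) (simp, erule trace_prod_mono[OF assms(2)])
  finally show ?thesis by simp
qed

text \<open>Worst family size after \<open>k\<close> increments, a tower-type function that depends
  on neither the vertex set nor the relations.\<close>

fun family_bound :: "nat \<Rightarrow> nat" where
  "family_bound 0 = 0"
| "family_bound (Suc k) = family_bound k + 2 * 4 ^ family_bound k"

lemma family_bound_mono: "k \<le> l \<Longrightarrow> family_bound k \<le> family_bound l"
  by (rule lift_Suc_mono_le) auto

lemma family_bound_step_mono: "k \<le> l \<Longrightarrow> k + 2 * 4 ^ k \<le> l + 2 * (4::nat) ^ l"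
  by (intro add_mono mult_left_mono power_increasing) auto

text \<open>Energy increment for all relations at once: the total energy is at most
  \<open>r * (card V)^2\<close>, while a family failing for some \<open>i\<close> can be enlarged
  with a gain of \<open>\<epsilon>^5 * (card V)^2\<close>. The number of rounds, and with it
  \<open>M\<close>, is fixed before \<open>V\<close> and \<open>E\<close>.\<close>

theorem lower_regularity_lemma:
  fixes \<epsilon> :: real
  assumes \<epsilon>: "0 < \<epsilon>"
  shows "\<exists>M. \<forall>(V :: 'a set) I (E :: 'i \<Rightarrow> ('a \<times> 'a) set). finite V \<longrightarrow> finite I \<longrightarrow> card I \<le> r \<longrightarrow>
    (\<exists>\<S>. finite \<S> \<and> card \<S> \<le> M \<and> (\<forall>i\<in>I.
      real (card {(x, y) \<in> V \<times> V. \<not> lower_regular \<epsilon> (E i) (atom V \<S> (trace \<S> x)) (atom V \<S> (trace \<S> y))})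
        \<le> \<epsilon> * (real (card V))\<^sup>2))"
proof -
  \<comment> \<open>More rounds than the total energy can pay for.\<close>
  obtain k :: nat where k: "real r < real k * \<epsilon> ^ 5"
    using reals_Archimedean3[of "\<epsilon> ^ 5"] \<epsilon> by auto
  show ?thesis
  proof (rule exI[of _ "family_bound k"], intro allI impI)
    fix V :: "'a set" and I :: "'i set" and E :: "'i \<Rightarrow> ('a \<times> 'a) set"
    assume V: "finite V" and I: "finite I" "card I \<le> r"
    define irr where "irr \<S> i = real (card {(x, y) \<in> V \<times> V.
        \<not> lower_regular \<epsilon> (E i) (atom V \<S> (trace \<S> x)) (atom V \<S> (trace \<S> y))})" for \<S> i
    define en where "en \<S> i = energy (V \<times> V) (map_prod (trace \<S>) (trace \<S>)) (\<lambda>p. of_bool (p \<in> E i))" for \<S> i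
    show "\<exists>\<S>. finite \<S> \<and> card \<S> \<le> family_bound k \<and> (\<forall>i\<in>I.
      real (card {(x, y) \<in> V \<times> V. \<not> lower_regular \<epsilon> (E i) (atom V \<S> (trace \<S> x)) (atom V \<S> (trace \<S> y))})
        \<le> \<epsilon> * (real (card V))\<^sup>2)"
    proof (rule ccontr)
      assume "\<not> ?thesis"
      then have bad: "\<exists>i\<in>I. \<epsilon> * (real (card V))\<^sup>2 < irr \<S> i" if "finite \<S>" "card \<S> \<le> family_bound k" for \<S>
        using that by (auto simp: irr_def not_le)
      have step: "\<exists>\<S>. finite \<S> \<and> card \<S> \<le> family_bound m \<and> real m * \<epsilon> ^ 5 * (real (card V))\<^sup>2 \<le> (\<Sum>i\<in>I. en \<S> i)"
        if "m \<le> k" for m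
        using that
      proof (induction m)
        case 0
        have "0 \<le> (\<Sum>i\<in>I. en {} i)" by (auto simp: en_def energy_def intro!: sum_nonneg)
        then show ?case by (intro exI[of _ "{}"]) auto
      next
        case (Suc m)
        then obtain \<S> where S: "finite \<S>" "card \<S> \<le> family_bound m"
          "real m * \<epsilon> ^ 5 * (real (card V))\<^sup>2 \<le> (\<Sum>i\<in>I. en \<S> i)" by auto
        have "card \<S> \<le> family_bound k" using S(2) family_bound_mono[of m k] Suc.prems by simp
        then obtain i where i: "i \<in> I" "\<epsilon> * (real (card V))\<^sup>2 < irr \<S> i" using bad S(1) by blast
        obtain \<T> where T: "finite \<T>" "\<S> \<subseteq> \<T>" "card \<T> \<le> card \<S> + 2 * 4 ^ card \<S>"
          "en \<S> i + \<epsilon> ^ 5 * (real (card V))\<^sup>2 \<le> en \<T> i"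
          using energy_increment_step[OF V S(1) \<epsilon> i(2)[unfolded irr_def]] unfolding en_def by metis
        have "(\<Sum>j\<in>I - {i}. en \<S> j) \<le> (\<Sum>j\<in>I - {i}. en \<T> j)"
          unfolding en_def by (intro sum_mono energy_mono_trace V T)
        then have "(\<Sum>j\<in>I. en \<S> j) + \<epsilon> ^ 5 * (real (card V))\<^sup>2 \<le> (\<Sum>j\<in>I. en \<T> j)"
          using T(4) by (simp add: sum.remove[OF I(1) i(1)])
        moreover have "card \<T> \<le> family_bound (Suc m)"
          using T(3) family_bound_step_mono[OF S(2)] by simp
        ultimately show ?case using S(3) T(1) by (intro exI[of _ \<T>]) (auto simp: algebra_simps)
      qed
      obtain \<S> where S: "real k * \<epsilon> ^ 5 * (real (card V))\<^sup>2 \<le> (\<Sum>i\<in>I. en \<S> i)" using step[of k] by auto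
      also have "\<dots> \<le> (\<Sum>i\<in>I. (real (card V))\<^sup>2)"
        unfolding en_def
        by (intro sum_mono order.trans[OF energy_le_card]) (auto simp: card_cartesian_product power2_eq_square)
      also have "\<dots> \<le> real r * (real (card V))\<^sup>2"
        using I(2) by (simp add: mult_right_mono)
      \<comment> \<open>For nonempty \<open>V\<close> the choice of \<open>k\<close> is already
        contradictory. What remains is the empty vertex set, where even the empty family leaves no
        irregular pair.\<close>
      finally have "card V = 0" using k by (simp add: mult_le_cancel_right)
      then have "V = {}" using V by simp
      then show False using bad[of "{}"] by (auto simp: irr_def)
    qed
  qed
qed

section \<open>Embedding cliques into dense regular clusters\<close>

text \<open>Vertices are chosen one at a time, each keeping at least a \<open>d\<close>-fraction of
  the candidates in every later cluster. Stopping before the last cluster leaves a whole set of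
  candidates there instead of a single vertex.\<close>

lemma greedy_embedding:
  fixes E :: "nat \<Rightarrow> nat \<Rightarrow> ('a \<times> 'a) set" and C :: "nat \<Rightarrow> 'a set"
  assumes C: "\<And>i. i < t \<Longrightarrow> finite (C i) \<and> C i \<noteq> {}"
    and d: "0 < d" "d \<le> 1" and \<epsilon>: "0 < \<epsilon>" "real t * \<epsilon> \<le> d ^ t"
    and dense: "\<And>i j A B. i < j \<Longrightarrow> j < t \<Longrightarrow> A \<subseteq> C i \<Longrightarrow> B \<subseteq> C j \<Longrightarrow>
       \<epsilon> * real (card (C i)) \<le> real (card A) \<Longrightarrow> \<epsilon> * real (card (C j)) \<le> real (card B) \<Longrightarrow>
       d * (real (card A) * real (card B)) \<le> real (card (E i j \<inter> A \<times> B))"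
    and "m < t"
  shows "\<exists>v. (\<forall>i j. i < j \<longrightarrow> j < m \<longrightarrow> (v i, v j) \<in> E i j) \<and>
     (\<forall>j. m \<le> j \<longrightarrow> j < t \<longrightarrow> d ^ m * real (card (C j)) \<le> real (card {w \<in> C j. \<forall>i<m. (v i, w) \<in> E i j}))"
  using \<open>m < t\<close>
proof (induction m)
  case 0
  then show ?case by simp
next
  case (Suc m)
  then obtain v where v: "\<And>i j. i < j \<Longrightarrow> j < m \<Longrightarrow> (v i, v j) \<in> E i j"
    and big: "\<And>j. m \<le> j \<Longrightarrow> j < t \<Longrightarrow> d ^ m * real (card (C j)) \<le> real (card {w \<in> C j. \<forall>i<m. (v i, w) \<in> E i j})"
    by force
  define B where "B j = {w \<in> C j. \<forall>i<m. (v i, w) \<in> E i j}" for j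
  have BC: "B j \<subseteq> C j" for j by (auto simp: B_def)
  have finB: "finite (B j)" if "j < t" for j using BC C[OF that] by (blast intro: finite_subset)
  have t: "1 \<le> real t" using Suc.prems by simp
  have \<epsilon>d: "real t * \<epsilon> \<le> d ^ m"
    using \<epsilon>(2) power_decreasing[of m t d] d Suc.prems by linarith
  have "\<epsilon> \<le> real t * \<epsilon>" using t \<epsilon>(1) by simp
  then have \<epsilon>d': "\<epsilon> \<le> d ^ m" using \<epsilon>d by linarith
  have bigB: "d ^ m * real (card (C j)) \<le> real (card (B j))" if "m \<le> j" "j < t" for j
    using big[OF that] by (simp add: B_def)
  have largeB: "\<epsilon> * real (card (C j)) \<le> real (card (B j))" if "m \<le> j" "j < t" for j
    using bigB[OF that] mult_right_mono[OF \<epsilon>d', of "real (card (C j))"] by simp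
  define N where "N u j = {w \<in> B j. (u, w) \<in> E m j}" for u j
  \<comment> \<open>Choices of the next vertex that would shrink the candidates in cluster
    \<open>j\<close> by more than the factor \<open>d\<close>.\<close>
  define bad where "bad j = {u \<in> B m. real (card (N u j)) < d * real (card (B j))}" for j
  have bad_small: "real (card (bad j)) < \<epsilon> * real (card (C m))" if j: "m < j" "j < t" for j
  \<comment> \<open>Otherwise \<open>bad j\<close> and \<open>B j\<close> are both large enough for
    \<open>dense\<close>, whose edge count contradicts the few neighbours of each vertex of
    \<open>bad j\<close>.\<close>
  proof (rule ccontr)
    assume *: "\<not> ?thesis"
    have "0 < card (C m)" using C[of m] Suc.prems by (simp add: card_gt_0_iff)
    then have "0 < real (card (bad j))" using * \<epsilon> by (smt (verit) mult_pos_pos of_nat_0_less_iff)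
    then have ne: "bad j \<noteq> {}" "finite (bad j)" by (auto simp: card_gt_0_iff)
    have "E m j \<inter> bad j \<times> B j = (SIGMA u:bad j. N u j)" by (auto simp: N_def)
    then have "card (E m j \<inter> bad j \<times> B j) = (\<Sum>u\<in>bad j. card (N u j))"
      using ne finB[OF j(2)] by (simp add: N_def)
    then have "real (card (E m j \<inter> bad j \<times> B j)) = (\<Sum>u\<in>bad j. real (card (N u j)))" by simp
    also have "\<dots> < (\<Sum>u\<in>bad j. d * real (card (B j)))"
      using ne by (intro sum_strict_mono) (auto simp: bad_def)
    also have "\<dots> = d * (real (card (bad j)) * real (card (B j)))" by simp
    also have "\<dots> \<le> real (card (E m j \<inter> bad j \<times> B j))"
      using j * largeB[of j] BC by (intro dense) (auto simp: bad_def B_def)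
    finally show False by simp
  qed
  \<comment> \<open>Union bound over the fewer than \<open>t\<close> later clusters: the bad
    vertices number less than \<open>t * \<epsilon> * card (C m)\<close>, which is at most
    \<open>card (B m)\<close>, so a good \<open>u\<close> remains.\<close>
  have "card (\<Union>j\<in>{m<..<t}. bad j) \<le> (\<Sum>j\<in>{m<..<t}. card (bad j))"
    by (rule card_UN_le) simp
  then have "real (card (\<Union>j\<in>{m<..<t}. bad j)) \<le> (\<Sum>j\<in>{m<..<t}. real (card (bad j)))"
    by (metis of_nat_mono of_nat_sum)
  also have "\<dots> \<le> (\<Sum>j\<in>{m<..<t}. \<epsilon> * real (card (C m)))"
    using bad_small by (intro sum_mono) (auto simp: less_imp_le)
  also have "\<dots> = real (t - Suc m) * (\<epsilon> * real (card (C m)))" by simp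
  also have "\<dots> < real t * (\<epsilon> * real (card (C m)))"
    using C[of m] Suc.prems \<epsilon> by (intro mult_strict_right_mono) (auto simp: card_gt_0_iff)
  also have "\<dots> \<le> d ^ m * real (card (C m))"
    using mult_right_mono[OF \<epsilon>d, of "real (card (C m))"] by (simp add: mult.assoc)
  also have "\<dots> \<le> real (card (B m))" using bigB[of m] Suc.prems by simp
  finally have "\<not> B m \<subseteq> (\<Union>j\<in>{m<..<t}. bad j)"
    using card_mono[of "\<Union>j\<in>{m<..<t}. bad j" "B m"] finB[of m] Suc.prems by (auto simp: bad_def not_le)
  then obtain u where "u \<in> B m" "u \<notin> (\<Union>j\<in>{m<..<t}. bad j)" by blast
  then have u: "u \<in> B m" "\<And>j. m < j \<Longrightarrow> j < t \<Longrightarrow> u \<notin> bad j" by auto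
  have Nset: "{w \<in> C j. \<forall>i<Suc m. ((v(m := u)) i, w) \<in> E i j} = N u j" for j
    by (auto simp: N_def B_def less_Suc_eq)
  have "d ^ Suc m * real (card (C j)) \<le> real (card (N u j))" if "Suc m \<le> j" "j < t" for j
  proof -
    have "d ^ Suc m * real (card (C j)) \<le> d * real (card (B j))"
      using bigB[of j] that d by (simp add: mult.assoc mult_left_mono)
    also have "\<dots> \<le> real (card (N u j))"
      using u that by (auto simp: bad_def not_less)
    finally show ?thesis .
  qed
  moreover have "((v(m := u)) i, (v(m := u)) j) \<in> E i j" if "i < j" "j < Suc m" for i j
    using that v u(1) by (auto simp: B_def less_Suc_eq)
  ultimately show ?case
    unfolding Nset[symmetric] by (intro exI[of _ "v(m := u)"]) blast
qed

section \<open>Counting what is discarded from the regular partition\<close>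

text \<open>Having a low average is constant on fibres, so the selected edges can be counted through
  the averages, each of them below \<delta>.\<close>

lemma card_low_average:
  assumes "finite X" "0 \<le> \<delta>"
  shows "real (card {x \<in> X. x \<in> E \<and> fibre_avg X \<phi> (\<lambda>p. of_bool (p \<in> E)) x < \<delta>}) \<le> \<delta> * real (card X)"
proof -
  let ?f = "\<lambda>p. of_bool (p \<in> E) :: real"
  let ?g = "\<lambda>x. of_bool (fibre_avg X \<phi> ?f x < \<delta>) :: real"
  have "real (card {x \<in> X. x \<in> E \<and> fibre_avg X \<phi> ?f x < \<delta>}) = (\<Sum>x\<in>X. ?g x * ?f x)"
    using \<open>finite X\<close> by (simp add: Int_def conj_commute flip: of_bool_conj)
  also have "\<dots> = (\<Sum>x\<in>X. ?g x * fibre_avg X \<phi> ?f x)"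
    by (intro sum_mult_fibre_avg[symmetric] \<open>finite X\<close>) (simp add: fibre_avg_def)
  also have "\<dots> \<le> (\<Sum>x\<in>X. \<delta>)" by (rule sum_mono) (use \<open>0 \<le> \<delta>\<close> in auto)
  finally show ?thesis by (simp add: mult.commute)
qed

text \<open>A family of at most \<open>M\<close> sets has at most \<open>2 ^ M\<close> atoms, each
  small one contributing less than \<open>\<beta> / 2 ^ M\<close>.\<close>

lemma card_small_atoms:
  assumes V: "finite V" and \<S>: "finite \<S>" "card \<S> \<le> M" and "0 \<le> \<beta>"
  shows "real (card {x \<in> V. real (card (atom V \<S> (trace \<S> x))) < \<beta> / 2 ^ M}) \<le> \<beta>"
proof -
  let ?P = "{a \<in> Pow \<S>. real (card (atom V \<S> a)) < \<beta> / 2 ^ M}"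
  have fin: "finite ?P" using \<S> by simp
  have "{x \<in> V. real (card (atom V \<S> (trace \<S> x))) < \<beta> / 2 ^ M} \<subseteq> (\<Union>a\<in>?P. atom V \<S> a)"
    using trace_in_Pow by (fastforce simp: atom_def)
  then have "card {x \<in> V. real (card (atom V \<S> (trace \<S> x))) < \<beta> / 2 ^ M} \<le> card (\<Union>a\<in>?P. atom V \<S> a)"
    using V fin by (intro card_mono) (auto simp: atom_def)
  also have "\<dots> \<le> (\<Sum>a\<in>?P. card (atom V \<S> a))" by (rule card_UN_le[OF fin])
  finally have "real (card {x \<in> V. real (card (atom V \<S> (trace \<S> x))) < \<beta> / 2 ^ M})
      \<le> (\<Sum>a\<in>?P. real (card (atom V \<S> a)))"
    unfolding of_nat_sum[symmetric] of_nat_le_iff .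
  also have "\<dots> \<le> (\<Sum>a\<in>?P. \<beta> / 2 ^ M)" by (rule sum_mono) auto
  also have "\<dots> = real (card ?P) * (\<beta> / 2 ^ M)" by simp
  also have "\<dots> \<le> 2 ^ M * (\<beta> / 2 ^ M)"
  proof (rule mult_right_mono)
    have "card ?P \<le> card (Pow \<S>)" using \<S> by (intro card_mono) auto
    also have "\<dots> \<le> 2 ^ M" using \<S> by (simp add: card_Pow power_increasing)
    finally show "real (card ?P) \<le> 2 ^ M" by (metis of_nat_mono of_nat_numeral of_nat_power)
  qed (use \<open>0 \<le> \<beta>\<close> in simp)
  finally show ?thesis by simp
qed

text \<open>A removal argument. The injectivity hypothesis expresses edge-disjointness: a discarded
  pair destroys at most one clique per position \<open>(i, j)\<close>, so discarding few pairs
  cannot hit quadratically many cliques. A surviving clique points to large, dense, regular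
  clusters, and greedy embedding finds two completions of one tuple of length
  \<open>t - 1\<close>.\<close>

lemma many_edge_disjoint_cliques_overlap:
  fixes \<alpha> :: real
  assumes \<alpha>: "0 < \<alpha>" and t: "2 \<le> t"
  shows "\<exists>n0. \<forall>(V :: 'a set) (E :: nat \<times> nat \<Rightarrow> ('a \<times> 'a) set) (F :: 's set) h.
    finite V \<longrightarrow> n0 \<le> card V \<longrightarrow> finite F \<longrightarrow> \<alpha> * (real (card V))\<^sup>2 \<le> real (card F) \<longrightarrow>
    (\<forall>S\<in>F. \<forall>i<t. h S i \<in> V) \<longrightarrow>
    (\<forall>S\<in>F. \<forall>i j. i < j \<longrightarrow> j < t \<longrightarrow> (h S i, h S j) \<in> E (i, j)) \<longrightarrow>
    (\<forall>i j. i < j \<longrightarrow> j < t \<longrightarrow> inj_on (\<lambda>S. (h S i, h S j)) F) \<longrightarrow>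
    (\<exists>v w w'. w \<noteq> w' \<and> (\<forall>i j. i < j \<longrightarrow> j < t - 1 \<longrightarrow> (v i, v j) \<in> E (i, j)) \<and>
       (\<forall>i<t - 1. (v i, w) \<in> E (i, t - 1) \<and> (v i, w') \<in> E (i, t - 1)))"
proof -
  \<comment> \<open>Each of the at most \<open>t^2\<close> positions loses at most
    \<open>5 * d * n^2\<close> cliques, and 8 in place of 5 gives strictness. The cap keeps
    \<open>d\<close> below 1.\<close>
  define d where "d = min (1/2) (\<alpha> / (8 * (real t)\<^sup>2))"
  \<comment> \<open>Chosen so that \<open>real t * \<epsilon> = d ^ t\<close>, the smallness
    required by \<open>greedy_embedding\<close>.\<close>
  define \<epsilon> where "\<epsilon> = d ^ t / real t"
  define I where "I = {(i, j). i < j \<and> j < t}"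
  have d: "0 < d" "d \<le> 1" using \<alpha> t by (auto simp: d_def)
  have \<epsilon>: "0 < \<epsilon>" using d t by (simp add: \<epsilon>_def)
  have "d ^ t \<le> d ^ 1" using d t by (intro power_decreasing) auto
  also have "d ^ 1 \<le> d * real t" using t d by simp
  finally have \<epsilon>d: "\<epsilon> \<le> d" using t by (simp add: \<epsilon>_def divide_le_eq)
  have I_sub: "I \<subseteq> {..<t} \<times> {..<t}" by (auto simp: I_def)
  then have finI: "finite I" by (rule finite_subset) simp
  have "card I \<le> card ({..<t} \<times> {..<t})" using I_sub by (intro card_mono) auto
  then have cardI: "card I \<le> t * t" by (simp add: card_cartesian_product)
  obtain M where M: "\<forall>(V :: 'a set) I (E :: nat \<times> nat \<Rightarrow> ('a \<times> 'a) set). finite V \<longrightarrow> finite I \<longrightarrow> card I \<le> t * t \<longrightarrow>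
    (\<exists>\<S>. finite \<S> \<and> card \<S> \<le> M \<and> (\<forall>i\<in>I.
      real (card {(x, y) \<in> V \<times> V. \<not> lower_regular \<epsilon> (E i) (atom V \<S> (trace \<S> x)) (atom V \<S> (trace \<S> y))})
        \<le> \<epsilon> * (real (card V))\<^sup>2))"
    using lower_regularity_lemma[OF \<epsilon>] by (rule exE)
  \<comment> \<open>From this size on \<open>d ^ t * n / 2 ^ M\<close> is at least 2, so the last
    candidate set contains two vertices.\<close>
  define n0 where "n0 = nat \<lceil>2 * 2 ^ M / d ^ t\<rceil> + 1"
  have n0: "2 * 2 ^ M / d ^ t \<le> real n0" by (simp add: n0_def) linarith
  show ?thesis
  proof (rule exI[of _ n0], intro allI impI)
    fix V :: "'a set" and E :: "nat \<times> nat \<Rightarrow> ('a \<times> 'a) set" and F :: "'s set" and h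
    assume V: "finite V" and nV: "n0 \<le> card V" and finF: "finite F"
      and FV: "\<alpha> * (real (card V))\<^sup>2 \<le> real (card F)"
      and hV: "\<forall>S\<in>F. \<forall>i<t. h S i \<in> V"
      and hE: "\<forall>S\<in>F. \<forall>i j. i < j \<longrightarrow> j < t \<longrightarrow> (h S i, h S j) \<in> E (i, j)"
      and inj: "\<forall>i j. i < j \<longrightarrow> j < t \<longrightarrow> inj_on (\<lambda>S. (h S i, h S j)) F"
    define n where "n = real (card V)"
    have n: "0 < n" "2 * 2 ^ M / d ^ t \<le> n" using n0 nV by (auto simp: n_def n0_def)
    obtain \<S> where S: "finite \<S>" "card \<S> \<le> M" and reg: "\<forall>p\<in>I.
      real (card {(x, y) \<in> V \<times> V. \<not> lower_regular \<epsilon> (E p) (atom V \<S> (trace \<S> x)) (atom V \<S> (trace \<S> y))}) \<le> \<epsilon> * n\<^sup>2"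
      using M[rule_format, OF V finI cardI, of E] unfolding n_def by (elim exE conjE)
    define cell where "cell x = atom V \<S> (trace \<S> x)" for x
    have fincell: "finite (cell x)" for x using V by (simp add: cell_def atom_def)
    define small where "small = {x \<in> V. real (card (cell x)) < d * n / 2 ^ M}"
    define irr where "irr p = {(x, y) \<in> V \<times> V. \<not> lower_regular \<epsilon> (E p) (cell x) (cell y)}" for p
    \<comment> \<open>The threshold is \<open>2 * d\<close> because lower regularity costs a further
      \<epsilon>, at most \<open>d\<close>, and density \<open>d\<close> has to remain on large
      subsets.\<close>
    define low where "low p = {(x, y) \<in> V \<times> V. (x, y) \<in> E p \<and> density (E p) (cell x) (cell y) < 2 * d}" for p
    \<comment> \<open>Irregular pairs contribute at most \<open>\<epsilon> * n^2\<close>, sparse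
      ones \<open>2 * d * n^2\<close>, pairs meeting a small cell \<open>2 * d * n^2\<close>:
      altogether at most \<open>5 * d * n^2\<close>.\<close>
    define bad where "bad p = irr p \<union> low p \<union> (small \<times> V \<union> V \<times> small)" for p
    have "bad p \<subseteq> V \<times> V" for p by (auto simp: bad_def irr_def low_def small_def)
    then have fin: "finite (bad p)" for p by (rule finite_subset) (simp add: V)
    have small: "real (card small) \<le> d * n"
      unfolding small_def cell_def using d n by (intro card_small_atoms V S) auto
    have low: "real (card (low p)) \<le> 2 * d * n\<^sup>2" for p
    proof -
      have "low p = {z \<in> V \<times> V. z \<in> E p \<and>
          fibre_avg (V \<times> V) (map_prod (trace \<S>) (trace \<S>)) (\<lambda>z. of_bool (z \<in> E p)) z < 2 * d}"
        by (auto simp: low_def fibre_avg_trace[OF V] cell_def)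
      then show ?thesis
        using card_low_average[of "V \<times> V" "2 * d" "E p" "map_prod (trace \<S>) (trace \<S>)"] V d
        by (simp add: card_cartesian_product n_def power2_eq_square)
    qed
    have bad: "real (card (bad p)) \<le> 5 * d * n\<^sup>2" if "p \<in> I" for p
    proof -
      have "card (bad p) \<le> card (irr p) + card (low p) + (card (small \<times> V) + card (V \<times> small))"
        unfolding bad_def by (intro order.trans[OF card_Un_le] add_mono card_Un_le)
      then have "real (card (bad p)) \<le> real (card (irr p)) + real (card (low p)) + 2 * (real (card small) * n)"
        unfolding n_def card_cartesian_product of_nat_mult[symmetric] mult.commute[of "card V" "card small"] by linarith
      also have "\<dots> \<le> \<epsilon> * n\<^sup>2 + 2 * d * n\<^sup>2 + 2 * (d * n * n)"
        using reg[rule_format, OF that] low[of p] small n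
        by (intro add_mono mult_left_mono mult_right_mono) (auto simp: irr_def cell_def)
      also have "\<dots> = (\<epsilon> + 4 * d) * n\<^sup>2" by (simp add: power2_eq_square algebra_simps)
      also have "\<dots> \<le> 5 * d * n\<^sup>2" using \<epsilon>d by (intro mult_right_mono) auto
      finally show ?thesis .
    qed
    define killed where "killed p = {S \<in> F. (h S (fst p), h S (snd p)) \<in> bad p}" for p
    have killed: "real (card (killed p)) \<le> 5 * d * n\<^sup>2" if "p \<in> I" for p
    proof -
      have "fst p < snd p" "snd p < t" using that by (auto simp: I_def)
      then have "inj_on (\<lambda>S. (h S (fst p), h S (snd p))) (killed p)"
        by (intro inj_on_subset[OF inj[rule_format]]) (auto simp: killed_def)
      then have "card (killed p) \<le> card (bad p)"
        by (rule card_inj_on_le) (auto simp: killed_def fin)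
      then show ?thesis using bad[OF that] by simp
    qed
    have "card (\<Union>p\<in>I. killed p) \<le> (\<Sum>p\<in>I. card (killed p))" by (rule card_UN_le[OF finI])
    then have "real (card (\<Union>p\<in>I. killed p)) \<le> (\<Sum>p\<in>I. real (card (killed p)))"
      by (metis of_nat_mono of_nat_sum)
    also have "\<dots> \<le> (\<Sum>p\<in>I. 5 * d * n\<^sup>2)" by (rule sum_mono) (rule killed)
    also have "\<dots> = real (card I) * (5 * d * n\<^sup>2)" by simp
    also have "\<dots> \<le> real (t * t) * (5 * d * n\<^sup>2)"
      using cardI d by (intro mult_right_mono) (auto simp del: of_nat_mult)
    also have "\<dots> = (real t)\<^sup>2 * d * 5 * n\<^sup>2" by (simp add: power2_eq_square)
    also have "\<dots> < \<alpha> * n\<^sup>2"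
    proof (rule mult_strict_right_mono)
      have "d \<le> \<alpha> / (8 * (real t)\<^sup>2)" by (simp add: d_def)
      then have "(real t)\<^sup>2 * d * 8 \<le> \<alpha>" using t by (simp add: field_simps)
      then show "(real t)\<^sup>2 * d * 5 < \<alpha>" using \<alpha> by linarith
    qed (use n in simp)
    also have "\<dots> \<le> real (card F)" using FV by (simp add: n_def)
    finally have "\<not> F \<subseteq> (\<Union>p\<in>I. killed p)"
      using card_mono[of "\<Union>p\<in>I. killed p" F] finI finF by (auto simp: killed_def)
    then obtain S where "S \<in> F" and "S \<notin> (\<Union>p\<in>I. killed p)" by blast
    then have good: "(h S i, h S j) \<notin> bad (i, j)" if "i < j" "j < t" for i j
      using that by (force simp: I_def killed_def)
    have hSV: "h S i \<in> V" if "i < t" for i using hV \<open>S \<in> F\<close> that by blast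
    \<comment> \<open>The surviving clique selects one cluster per index; clusters of different
      indices may coincide.\<close>
    define C where "C i = cell (h S i)" for i
    have Cbig: "d * n / 2 ^ M \<le> real (card (C i))" if "i < t" for i
    proof -
      \<comment> \<open>Smallness is excluded only through pairs, so vertex 0 is tested together
        with vertex 1 and every other vertex together with vertex 0.\<close>
      have "h S i \<notin> small"
      proof (cases "i = 0")
        case True
        then show ?thesis using good[of 0 1] t hSV[of 1] by (auto simp: bad_def)
      next
        case False
        then show ?thesis using good[of 0 i] t hSV[of 0] that by (auto simp: bad_def)
      qed
      then show ?thesis using hSV[OF that] by (auto simp: small_def C_def)
    qed
    have dn: "0 < d * n / 2 ^ M" using d n by simp
    have "\<exists>v. (\<forall>i j. i < j \<longrightarrow> j < t - 1 \<longrightarrow> (v i, v j) \<in> E (i, j)) \<and>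
     (\<forall>j. t - 1 \<le> j \<longrightarrow> j < t \<longrightarrow> d ^ (t - 1) * real (card (C j)) \<le> real (card {w \<in> C j. \<forall>i<t - 1. (v i, w) \<in> E (i, j)}))"
    proof (rule greedy_embedding[where E = "\<lambda>i j. E (i, j)" and \<epsilon> = \<epsilon>])
      show "finite (C i) \<and> C i \<noteq> {}" if "i < t" for i
        using Cbig[OF that] dn fincell by (auto simp: C_def)
      show "real t * \<epsilon> \<le> d ^ t" using t by (simp add: \<epsilon>_def)
      fix i j A B assume ij: "i < j" "j < t" and AB: "A \<subseteq> C i" "B \<subseteq> C j"
        "\<epsilon> * real (card (C i)) \<le> real (card A)" "\<epsilon> * real (card (C j)) \<le> real (card B)"
      have "(h S i, h S j) \<in> E (i, j)" using hE \<open>S \<in> F\<close> ij by blast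
      then have *: "lower_regular \<epsilon> (E (i, j)) (C i) (C j)" "2 * d \<le> density (E (i, j)) (C i) (C j)"
        using good[OF ij] hSV[of i] hSV[of j] ij by (auto simp: bad_def irr_def low_def C_def not_less)
      have "d * (real (card A) * real (card B)) \<le> (density (E (i, j)) (C i) (C j) - \<epsilon>) * (real (card A) * real (card B))"
        using *(2) \<epsilon>d by (intro mult_right_mono) auto
      also have "\<dots> \<le> real (card (E (i, j) \<inter> A \<times> B))"
        using *(1) AB unfolding lower_regular_def by blast
      finally show "d * (real (card A) * real (card B)) \<le> real (card (E (i, j) \<inter> A \<times> B))" .
    qed (use d \<epsilon> t in auto)
    then obtain v where v: "\<forall>i j. i < j \<longrightarrow> j < t - 1 \<longrightarrow> (v i, v j) \<in> E (i, j)"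
      and vbig: "d ^ (t - 1) * real (card (C (t - 1))) \<le> real (card {w \<in> C (t - 1). \<forall>i<t - 1. (v i, w) \<in> E (i, t - 1)})"
      using t by auto
    have "2 \<le> d ^ t * n / 2 ^ M" using n(2) d by (simp add: field_simps)
    also have "\<dots> = d ^ (t - 1) * (d * n / 2 ^ M)" using t by (cases t) auto
    also have "\<dots> \<le> d ^ (t - 1) * real (card (C (t - 1)))" using Cbig[of "t - 1"] t d by (intro mult_left_mono) auto
    finally have "\<not> card {w \<in> C (t - 1). \<forall>i<t - 1. (v i, w) \<in> E (i, t - 1)} \<le> Suc 0" using vbig by linarith
    then obtain w w' where "w \<noteq> w'" "w \<in> {w \<in> C (t - 1). \<forall>i<t - 1. (v i, w) \<in> E (i, t - 1)}"
      "w' \<in> {w \<in> C (t - 1). \<forall>i<t - 1. (v i, w) \<in> E (i, t - 1)}"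
      using fincell by (subst (asm) card_le_Suc0_iff_eq) (auto simp: C_def)
    then show "\<exists>v w w'. w \<noteq> w' \<and> (\<forall>i j. i < j \<longrightarrow> j < t - 1 \<longrightarrow> (v i, v j) \<in> E (i, j)) \<and>
       (\<forall>i<t - 1. (v i, w) \<in> E (i, t - 1) \<and> (v i, w') \<in> E (i, t - 1))"
      using v by (intro exI[of _ v] exI[of _ w] exI[of _ w']) auto
  qed
qed

section \<open>The upper bound\<close>

text \<open>Averaging over all maps from \<open>C\<close> to \<open>I\<close>: for fixed
  \<open>S\<close>, injectivity of \<open>\<phi> S\<close> means that alignment prescribes the value
  at exactly \<open>card I\<close> colours, so a fraction of one in \<open>card I ^ card I\<close>
  maps is aligned with \<open>S\<close>. Double counting replaces probability.\<close>

lemma exists_aligned_labelling: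
  fixes \<phi> :: "'s \<Rightarrow> 'i \<Rightarrow> 'c"
  assumes "finite F" "finite I" "I \<noteq> {}" "finite C"
    and \<phi>: "\<And>S. S \<in> F \<Longrightarrow> inj_on (\<phi> S) I" "\<And>S. S \<in> F \<Longrightarrow> \<phi> S ` I \<subseteq> C"
  shows "\<exists>\<chi>. card F \<le> card I ^ card I * card {S \<in> F. \<forall>i\<in>I. \<chi> (\<phi> S i) = i}"
proof (rule ccontr)
  let ?k = "card I" and ?\<Omega> = "C \<rightarrow>\<^sub>E I"
  let ?good = "\<lambda>\<chi> S. \<forall>i\<in>I. \<chi> (\<phi> S i) = i"
  assume "\<not> ?thesis"
  then have lt: "?k ^ ?k * card {S \<in> F. ?good \<chi> S} < card F" for \<chi> by (simp add: not_le)
  have fin\<Omega>: "finite ?\<Omega>" using assms by (intro finite_PiE) auto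
  have card\<Omega>: "card ?\<Omega> = ?k ^ card C" using assms by (simp add: card_PiE)
  have k: "0 < ?k" using assms by (simp add: card_gt_0_iff)
  have cnt: "?k ^ ?k * card {\<chi> \<in> ?\<Omega>. ?good \<chi> S} = ?k ^ card C" if S: "S \<in> F" for S
  proof -
    let ?J = "\<phi> S ` I"
    have inj: "inj_on (\<phi> S) I" and sub: "?J \<subseteq> C" using \<phi> S by auto
    \<comment> \<open>The maps aligned with \<open>S\<close> form a product set: a forced value at
      each colour used by \<open>S\<close>, all of \<open>I\<close> elsewhere.\<close>
    define D where "D c = (if c \<in> ?J then {the_inv_into I (\<phi> S) c} else I)" for c
    have "{\<chi> \<in> ?\<Omega>. ?good \<chi> S} = (\<Pi>\<^sub>E c\<in>C. D c)"
    proof (intro set_eqI iffI)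
      fix \<chi> assume *: "\<chi> \<in> {\<chi> \<in> ?\<Omega>. ?good \<chi> S}"
      show "\<chi> \<in> (\<Pi>\<^sub>E c\<in>C. D c)"
        using * inj by (auto simp: D_def PiE_iff the_inv_into_f_f)
    next
      fix \<chi> assume *: "\<chi> \<in> (\<Pi>\<^sub>E c\<in>C. D c)"
      have "\<chi> c \<in> I" if "c \<in> C" for c
        using PiE_mem[OF * that] inj by (auto simp: D_def the_inv_into_f_f split: if_splits)
      moreover have "\<chi> (\<phi> S i) = i" if "i \<in> I" for i
        using PiE_mem[OF *, of "\<phi> S i"] sub inj that by (auto simp: D_def the_inv_into_f_f)
      ultimately show "\<chi> \<in> {\<chi> \<in> ?\<Omega>. ?good \<chi> S}" using * by (auto simp: PiE_iff)
    qed
    then have "card {\<chi> \<in> ?\<Omega>. ?good \<chi> S} = (\<Prod>c\<in>C. card (D c))"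
      using \<open>finite C\<close> by (simp add: card_PiE)
    also have "\<dots> = (\<Prod>c\<in>C - ?J. card (D c)) * (\<Prod>c\<in>?J. card (D c))"
      using sub \<open>finite C\<close> by (rule prod.subset_diff)
    also have "\<dots> = ?k ^ card (C - ?J)" by (simp add: D_def)
    also have "card (C - ?J) = card C - ?k"
      using sub \<open>finite I\<close> inj by (simp add: card_Diff_subset card_image)
    finally have "card {\<chi> \<in> ?\<Omega>. ?good \<chi> S} = ?k ^ (card C - ?k)" .
    moreover have "?k \<le> card C" using card_mono[OF \<open>finite C\<close> sub] inj by (simp add: card_image)
    ultimately show ?thesis by (simp flip: power_add)
  qed
  have "card F * ?k ^ card C = (\<Sum>S\<in>F. ?k ^ ?k * card {\<chi> \<in> ?\<Omega>. ?good \<chi> S})"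
    using cnt by simp
  also have "\<dots> = ?k ^ ?k * (\<Sum>S\<in>F. card {\<chi> \<in> ?\<Omega>. ?good \<chi> S})" by (simp add: sum_distrib_left)
  also have "(\<Sum>S\<in>F. card {\<chi> \<in> ?\<Omega>. ?good \<chi> S}) = (\<Sum>\<chi>\<in>?\<Omega>. card {S \<in> F. ?good \<chi> S})"
    using sum.swap_restrict[OF \<open>finite F\<close> fin\<Omega>, of "\<lambda>_ _. 1::nat" "\<lambda>S \<chi>. ?good \<chi> S"] by simp
  also have "?k ^ ?k * \<dots> = (\<Sum>\<chi>\<in>?\<Omega>. ?k ^ ?k * card {S \<in> F. ?good \<chi> S})" by (rule sum_distrib_left)
  also have "\<dots> < (\<Sum>\<chi>\<in>?\<Omega>. card F)"
    using lt fin\<Omega> card\<Omega> k by (intro sum_strict_mono) (auto simp flip: card_0_eq)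
  also have "\<dots> = card F * ?k ^ card C" using card\<Omega> by simp
  finally show False by simp
qed

section \<open>Edges of vertex sets, rainbow cliques and the subquadratic bound\<close>

lemma doubleton_in_edges_of_iff: "{x, y} \<in> edges_of S \<longleftrightarrow> x \<in> S \<and> y \<in> S \<and> x \<noteq> y"
  by (auto simp: edges_of_def card_insert_if)

lemma edges_of_image:
  fixes u :: "nat \<Rightarrow> nat"
  assumes "inj_on u {..<t}"
  shows "edges_of (u ` {..<t}) = (\<lambda>(i, j). {u i, u j}) ` {(i, j). i < j \<and> j < t}"
proof (intro equalityI subsetI)
  fix e assume e: "e \<in> edges_of (u ` {..<t})"
  then obtain x y where xy: "e = {x, y}" by (auto simp: edges_of_def card_2_iff)
  with e obtain i j where ij: "x = u i" "y = u j" "i < t" "j < t" "u i \<noteq> u j"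
    by (auto simp: doubleton_in_edges_of_iff)
  then have "i \<noteq> j" by auto
  then have "i < j \<or> j < i" by auto
  then show "e \<in> (\<lambda>(i, j). {u i, u j}) ` {(i, j). i < j \<and> j < t}"
  proof
    assume "i < j" then show ?thesis using ij xy by (intro image_eqI[of _ _ "(i, j)"]) auto
  next
    assume "j < i" then show ?thesis using ij xy by (intro image_eqI[of _ _ "(j, i)"]) auto
  qed
next
  fix e assume "e \<in> (\<lambda>(i, j). {u i, u j}) ` {(i, j). i < j \<and> j < t}"
  then obtain i j where ij: "i < j" "j < t" "e = {u i, u j}" by auto
  then have "u i \<noteq> u j" using assms by (auto dest: inj_onD)
  with ij show "e \<in> edges_of (u ` {..<t})" by (auto simp: doubleton_in_edges_of_iff)
qed

lemma finite_edges_of: "finite S \<Longrightarrow> finite (edges_of S)"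
  by (rule finite_subset[of _ "Pow S"]) (auto simp: edges_of_def)

lemma finite_rainbow_cliques: "finite (rainbow_cliques t n c)"
  by (rule finite_subset[of _ "Pow {..<n}"]) (auto simp: rainbow_cliques_def rainbow_clique_def)

lemma almost_gallai_unique:
  assumes "almost_gallai t n c" "S \<in> rainbow_cliques t n c" "T \<in> rainbow_cliques t n c"
    and "x \<in> S" "x \<in> T" "y \<in> S" "y \<in> T" "x \<noteq> y"
  shows "S = T"
proof (rule ccontr)
  assume "S \<noteq> T"
  moreover have "{x, y} \<in> edges_of S" "{x, y} \<in> edges_of T"
    using assms by (auto simp: doubleton_in_edges_of_iff)
  ultimately show False
    using assms(1-3) unfolding almost_gallai_def rainbow_cliques_def by blast
qed

text \<open>The label of its colour recovers the position of an edge, so equal colours force equal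
  edges. This is how embedded tuples are recognised as rainbow.\<close>

lemma rainbow_clique_if_labelled:
  assumes u: "\<And>i. i < t \<Longrightarrow> u i < n"
    and \<chi>: "\<And>i j. i < j \<Longrightarrow> j < t \<Longrightarrow> u i \<noteq> u j \<and> \<chi> (c {u i, u j}) = (i, j)"
  shows "u ` {..<t} \<in> rainbow_cliques t n c"
proof -
  have inj: "inj_on u {..<t}"
  proof (rule inj_onI)
    fix i j assume "i \<in> {..<t}" "j \<in> {..<t}" "u i = u j"
    then show "i = j" using \<chi>[of i j] \<chi>[of j i] by (cases i j rule: linorder_cases) auto
  qed
  have "inj_on c (edges_of (u ` {..<t}))"
    unfolding edges_of_image[OF inj]
  proof (rule inj_onI)
    fix e e' assume e: "e \<in> (\<lambda>(i, j). {u i, u j}) ` {(i, j). i < j \<and> j < t}"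
      "e' \<in> (\<lambda>(i, j). {u i, u j}) ` {(i, j). i < j \<and> j < t}" "c e = c e'"
    then obtain i j i' j' where *: "i < j" "j < t" "e = {u i, u j}" "i' < j'" "j' < t" "e' = {u i', u j'}" by auto
    then have "\<chi> (c e) = (i, j)" "\<chi> (c e') = (i', j')" using \<chi> by auto
    with e(3) * show "e = e'" by simp
  qed
  then show ?thesis
    using u inj by (auto simp: rainbow_cliques_def rainbow_clique_def card_image)
qed

text \<open>The threshold is uniform over all colourings, as the passage to the maximum
  \<open>tau\<close> requires.\<close>

lemma rainbow_cliques_subquadratic:
  assumes t: "3 \<le> t" and \<delta>: "0 < \<delta>"
  shows "\<exists>n0. \<forall>n\<ge>n0. \<forall>c. almost_gallai t n c \<longrightarrow> real (card (rainbow_cliques t n c)) < \<delta> * (real n)\<^sup>2"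
proof -
  define I where "I = {(i, j). i < j \<and> j < t}"
  have "I \<subseteq> {..<t} \<times> {..<t}" by (auto simp: I_def)
  then have finI: "finite I" by (rule finite_subset) simp
  have "(0, 1) \<in> I" using t by (auto simp: I_def)
  then have I: "I \<noteq> {}" by blast
  define k where "k = card I ^ card I"
  have k: "0 < k" using finI I by (simp add: k_def card_gt_0_iff)
  \<comment> \<open>Passing to the aligned cliques costs the factor \<open>k\<close>.\<close>
  define \<alpha> where "\<alpha> = \<delta> / real k"
  have \<alpha>: "0 < \<alpha>" using \<delta> k by (simp add: \<alpha>_def)
  obtain n0 where n0: "\<forall>(V :: nat set) (E :: nat \<times> nat \<Rightarrow> (nat \<times> nat) set) (F :: nat set set) h.
    finite V \<longrightarrow> n0 \<le> card V \<longrightarrow> finite F \<longrightarrow> \<alpha> * (real (card V))\<^sup>2 \<le> real (card F) \<longrightarrow>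
    (\<forall>S\<in>F. \<forall>i<t. h S i \<in> V) \<longrightarrow>
    (\<forall>S\<in>F. \<forall>i j. i < j \<longrightarrow> j < t \<longrightarrow> (h S i, h S j) \<in> E (i, j)) \<longrightarrow>
    (\<forall>i j. i < j \<longrightarrow> j < t \<longrightarrow> inj_on (\<lambda>S. (h S i, h S j)) F) \<longrightarrow>
    (\<exists>v w w'. w \<noteq> w' \<and> (\<forall>i j. i < j \<longrightarrow> j < t - 1 \<longrightarrow> (v i, v j) \<in> E (i, j)) \<and>
       (\<forall>i<t - 1. (v i, w) \<in> E (i, t - 1) \<and> (v i, w') \<in> E (i, t - 1)))"
    using many_edge_disjoint_cliques_overlap[OF \<alpha>, of t] t by auto
  show ?thesis
  proof (rule exI[of _ n0], intro allI impI, rule ccontr)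
    fix n c assume n: "n0 \<le> n" and ag: "almost_gallai t n c"
      and many: "\<not> real (card (rainbow_cliques t n c)) < \<delta> * (real n)\<^sup>2"
    define R where "R = rainbow_cliques t n c"
    have finR: "finite R" by (simp add: R_def finite_rainbow_cliques)
    have R: "S \<subseteq> {..<n}" "card S = t" "inj_on c (edges_of S)" "finite S" if "S \<in> R" for S
      using that by (auto simp: R_def rainbow_cliques_def rainbow_clique_def intro: finite_subset)
    have "\<forall>S\<in>R. \<exists>h. bij_betw h {..<t} S"
      using R ex_bij_betw_nat_finite by (metis lessThan_atLeast0)
    \<comment> \<open>The vertices of each clique are ordered arbitrarily; alignment refers to this
      order.\<close>
    then obtain h where h: "\<And>S. S \<in> R \<Longrightarrow> bij_betw (h S) {..<t} S" by metis
    have hinj: "inj_on (h S) {..<t}" and him: "h S ` {..<t} = S" if "S \<in> R" for S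
      using h[OF that] by (auto simp: bij_betw_def)
    define \<phi> where "\<phi> S = (\<lambda>(i, j). c {h S i, h S j})" for S
    have inj\<phi>: "inj_on (\<phi> S) I" if "S \<in> R" for S
    proof (rule inj_onI, clarify)
      fix i j i' j' assume ij: "(i, j) \<in> I" "(i', j') \<in> I" "\<phi> S (i, j) = \<phi> S (i', j')"
      have edge: "{h S a, h S b} \<in> edges_of S" if "(a, b) \<in> I" for a b
        using edges_of_image[OF hinj[OF \<open>S \<in> R\<close>]] that by (auto simp: him[OF \<open>S \<in> R\<close>] I_def)
      have "{h S i, h S j} = {h S i', h S j'}"
        using inj_onD[OF R(3)[OF \<open>S \<in> R\<close>] _ edge edge] ij by (auto simp: \<phi>_def)
      moreover have "h S a = h S b \<longleftrightarrow> a = b" if "a < t" "b < t" for a b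
        using inj_on_eq_iff[OF hinj[OF \<open>S \<in> R\<close>]] that by simp
      ultimately show "i = i' \<and> j = j'"
        using ij(1,2) by (auto simp: doubleton_eq_iff I_def)
    qed
    have \<phi>C: "\<phi> S ` I \<subseteq> c ` edges_of {..<n}" if "S \<in> R" for S
    proof -
      have "edges_of S \<subseteq> edges_of {..<n}" using R(1)[OF that] by (auto simp: edges_of_def)
      moreover have "\<phi> S ` I = c ` edges_of S"
        using edges_of_image[OF hinj[OF that]] by (simp add: him[OF that] I_def \<phi>_def image_image split_def)
      ultimately show ?thesis by auto
    qed
    obtain \<chi> where \<chi>: "card R \<le> k * card {S \<in> R. \<forall>p\<in>I. \<chi> (\<phi> S p) = p}"
      using exists_aligned_labelling[of R I "c ` edges_of {..<n}" \<phi>] finR finI I finite_edges_of inj\<phi> \<phi>C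
      by (auto simp: k_def)
    define F where "F = {S \<in> R. \<forall>p\<in>I. \<chi> (\<phi> S p) = p}"
    \<comment> \<open>The relation has no loops, which later keeps the embedded vertices
      distinct.\<close>
    define E where "E p = {(x, y). x < n \<and> y < n \<and> x \<noteq> y \<and> \<chi> (c {x, y}) = p}" for p
    have hn: "h S i < n" if "S \<in> R" "i < t" for S i using him[OF that(1)] R(1)[OF that(1)] that(2) by auto
    have "real (card R) \<le> real (k * card F)" using \<chi> unfolding F_def of_nat_le_iff .
    then have "\<delta> * (real n)\<^sup>2 \<le> real k * real (card F)" using many by (simp add: R_def)
    then have "\<alpha> * (real n)\<^sup>2 \<le> real (card F)" using k by (simp add: \<alpha>_def divide_le_eq mult.commute)
    \<comment> \<open>The almost Gallai property enters here: two common vertices identify the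
      cliques.\<close>
    moreover have "inj_on (\<lambda>S. (h S i, h S j)) F" if ij: "i < j" "j < t" for i j
    proof (rule inj_onI)
      fix S T assume ST: "S \<in> F" "T \<in> F" "(h S i, h S j) = (h T i, h T j)"
      then have SR: "S \<in> R" "T \<in> R" by (auto simp: F_def)
      have "h S i \<noteq> h S j" using inj_onD[OF hinj[OF SR(1)]] ij by fastforce
      moreover have "h S i \<in> S" "h S j \<in> S" "h T i \<in> T" "h T j \<in> T"
        using bij_betwE[OF h[OF SR(1)]] bij_betwE[OF h[OF SR(2)]] ij by auto
      ultimately show "S = T" using almost_gallai_unique[OF ag, of S T "h S i" "h S j"] SR ST(3) by (auto simp: R_def)
    qed
    moreover have "(h S i, h S j) \<in> E (i, j)" if "S \<in> F" "i < j" "j < t" for S i j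
    proof -
      have SR: "S \<in> R" and "\<forall>p\<in>I. \<chi> (\<phi> S p) = p" using that by (auto simp: F_def)
      then have "\<chi> (c {h S i, h S j}) = (i, j)" using that by (auto simp: I_def \<phi>_def)
      moreover have "h S i \<noteq> h S j" using inj_onD[OF hinj[OF SR]] that by fastforce
      ultimately show ?thesis using hn[OF SR] that by (auto simp: E_def)
    qed
    ultimately have "\<exists>v w w'. w \<noteq> w' \<and> (\<forall>i j. i < j \<longrightarrow> j < t - 1 \<longrightarrow> (v i, v j) \<in> E (i, j)) \<and>
       (\<forall>i<t - 1. (v i, w) \<in> E (i, t - 1) \<and> (v i, w') \<in> E (i, t - 1))"
      using n finR hn by (intro n0[rule_format, of "{..<n}" F h E]) (auto simp: F_def)
    then obtain v w w' where "w \<noteq> w'" and v: "\<And>i j. i < j \<Longrightarrow> j < t - 1 \<Longrightarrow> (v i, v j) \<in> E (i, j)"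
       and w: "\<And>i. i < t - 1 \<Longrightarrow> (v i, w) \<in> E (i, t - 1)" and w': "\<And>i. i < t - 1 \<Longrightarrow> (v i, w') \<in> E (i, t - 1)"
      by blast
    have clique: "insert z (v ` {..<t - 1}) \<in> R" if z: "\<And>i. i < t - 1 \<Longrightarrow> (v i, z) \<in> E (i, t - 1)" for z
    proof -
      let ?u = "v(t - 1 := z)"
      have "?u ` {..<t} = insert z (v ` {..<t - 1})"
        using t lessThan_Suc[of "t - 1"] by (auto simp: fun_upd_def)
      moreover have "?u ` {..<t} \<in> rainbow_cliques t n c"
      proof (rule rainbow_clique_if_labelled[where \<chi> = \<chi>])
        fix i assume "i < t"
        then show "?u i < n" using z[of i] z[of 0] t by (cases "i = t - 1") (auto simp: E_def)
      next
        fix i j assume "i < j" "j < t"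
        then show "?u i \<noteq> ?u j \<and> \<chi> (c {?u i, ?u j}) = (i, j)"
          using z[of i] v[of i j] by (cases "j = t - 1") (auto simp: E_def)
      qed
      ultimately show ?thesis by (simp add: R_def)
    qed
    \<comment> \<open>Both cliques contain the edge between \<open>v 0\<close> and
      \<open>v 1\<close>; the indices 0 and 1 lie below \<open>t - 1\<close> because
      \<open>t \<ge> 3\<close>.\<close>
    have "insert w (v ` {..<t - 1}) = insert w' (v ` {..<t - 1})"
      using v[of 0 1] t
      by (intro almost_gallai_unique[OF ag clique[OF w, unfolded R_def] clique[OF w', unfolded R_def], of "v 0" "v 1"])
        (auto simp: E_def)
    moreover have "w \<notin> v ` {..<t - 1}" using w by (fastforce simp: E_def)
    ultimately show False using \<open>w \<noteq> w'\<close> by blast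
  qed
qed

section \<open>The extremal number \<open>tau\<close>\<close>

text \<open>There are infinitely many colourings, but a count never exceeds the number of vertex
  subsets; hence \<open>Max\<close> in \<open>tau\<close> ranges over a finite set.\<close>

lemma finite_clique_counts: "finite {k. \<exists>c. almost_gallai t n c \<and> card (rainbow_cliques t n c) = k}"
proof (rule finite_subset)
  show "{k. \<exists>c. almost_gallai t n c \<and> card (rainbow_cliques t n c) = k} \<subseteq> {..card (Pow {..<n})}"
    by (auto simp: rainbow_cliques_def rainbow_clique_def intro!: card_mono simp del: card_Pow)
qed simp

lemma le_tau: "almost_gallai t n c \<Longrightarrow> card (rainbow_cliques t n c) \<le> tau t n"
  unfolding tau_def by (rule Max_ge[OF finite_clique_counts]) blast

text \<open>\<open>Max\<close> also needs a nonempty set. The constant colouring provides an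
  element: for \<open>t \<ge> 3\<close> a clique has two edges of equal colour, so nothing is
  rainbow and the condition is vacuous.\<close>

lemma tau_attained:
  assumes t: "3 \<le> t"
  shows "\<exists>c. almost_gallai t n c \<and> card (rainbow_cliques t n c) = tau t n"
proof -
  have no: "\<not> rainbow_clique t n (\<lambda>_. 0) S" for S
  proof
    assume S: "rainbow_clique t n (\<lambda>_. 0) S"
    then have "3 \<le> card S" using t by (simp add: rainbow_clique_def)
    then obtain T where "T \<subseteq> S" "card T = 3" by (meson obtain_subset_with_card_n)
    then obtain x y z where "x \<in> S" "y \<in> S" "z \<in> S" "x \<noteq> y" "y \<noteq> z" "x \<noteq> z" by (auto simp: card_3_iff)
    then have "{x, y} \<in> edges_of S" "{x, z} \<in> edges_of S" "{x, y} \<noteq> {x, z}"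
      by (auto simp: doubleton_in_edges_of_iff doubleton_eq_iff)
    then show False using S inj_onD[of "\<lambda>_. 0 :: nat" "edges_of S" "{x, y}" "{x, z}"] by (simp add: rainbow_clique_def)
  qed
  then have "almost_gallai t n (\<lambda>_. 0)" by (auto simp: almost_gallai_def)
  then have "{k. \<exists>c. almost_gallai t n c \<and> card (rainbow_cliques t n c) = k} \<noteq> {}" by blast
  from Max_in[OF finite_clique_counts this] show ?thesis by (simp add: tau_def)
qed

lemma tau_subquadratic:
  assumes "3 \<le> t"
  shows "(\<lambda>n. real (tau t n) / (real n) ^ 2) \<longlonglongrightarrow> 0"
proof (rule LIMSEQ_I)
  fix r :: real assume r: "0 < r"
  obtain n0 where n0: "\<And>n c. n0 \<le> n \<Longrightarrow> almost_gallai t n c \<Longrightarrow> real (card (rainbow_cliques t n c)) < r * (real n)\<^sup>2"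
    using rainbow_cliques_subquadratic[OF assms r] by blast
  \<comment> \<open>The 1 keeps \<open>n\<close> positive, so that the inequality may be divided by
    its square.\<close>
  have "norm (real (tau t n) / (real n)\<^sup>2 - 0) < r" if "max 1 n0 \<le> n" for n
  proof -
    obtain c where "almost_gallai t n c" "card (rainbow_cliques t n c) = tau t n"
      using tau_attained[OF assms] by blast
    then have "real (tau t n) < r * (real n)\<^sup>2" using n0[of n c] that by simp
    then show ?thesis using that by (simp add: divide_less_eq)
  qed
  then show "\<exists>no. \<forall>n\<ge>no. norm (real (tau t n) / (real n)\<^sup>2 - 0) < r" by blast
qed

section \<open>The lower bound\<close>

definition base_value :: "nat \<Rightarrow> nat \<Rightarrow> (nat \<Rightarrow> nat) \<Rightarrow> nat" where
  "base_value B d x = (\<Sum>i<d. x i * B ^ i)"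

lemma base_value_Suc: "base_value B (Suc d) x = x 0 + B * base_value B d (\<lambda>i. x (Suc i))"
  by (simp add: base_value_def sum.lessThan_Suc_shift sum_distrib_left mult_ac del: sum.lessThan_Suc)

lemma base_value_less:
  assumes "\<And>i. i < d \<Longrightarrow> x i < B"
  shows "base_value B d x < B ^ d"
  using assms
proof (induction d arbitrary: x)
  case 0
  then show ?case by (simp add: base_value_def)
next
  case (Suc d)
  have "Suc (base_value B d (\<lambda>i. x (Suc i))) \<le> B ^ d" using Suc by (simp add: Suc_leI)
  then have "B * Suc (base_value B d (\<lambda>i. x (Suc i))) \<le> B * B ^ d" by (rule mult_le_mono2)
  moreover have "x 0 < B" using Suc.prems by simp
  ultimately show ?case by (simp add: base_value_Suc)
qed

lemma base_value_inject:
  assumes "base_value B d x = base_value B d y" "\<And>i. i < d \<Longrightarrow> x i < B" "\<And>i. i < d \<Longrightarrow> y i < B" "i < d"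
  shows "x i = y i"
  using assms
proof (induction d arbitrary: x y i)
  case 0
  then show ?case by simp
next
  case (Suc d)
  have less: "x 0 < B" "y 0 < B" using Suc.prems by auto
  have eq: "x 0 + B * base_value B d (\<lambda>i. x (Suc i)) = y 0 + B * base_value B d (\<lambda>i. y (Suc i))"
    using Suc.prems(1) by (simp add: base_value_Suc)
  have "x 0 = y 0" using arg_cong[OF eq, of "\<lambda>m. m mod B"] less by simp
  moreover have "base_value B d (\<lambda>i. x (Suc i)) = base_value B d (\<lambda>i. y (Suc i))"
    using eq calculation less by simp
  then have "x (Suc j) = y (Suc j)" if "j < d" for j
    using Suc.IH[of "\<lambda>i. x (Suc i)" "\<lambda>i. y (Suc i)" j] Suc.prems(2,3) that by simp
  ultimately show ?case using Suc.prems(4) by (cases i) auto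
qed

text \<open>Strict convexity of a sphere: \<open>z\<close> is a proper convex combination of
  \<open>x\<close> and \<open>y\<close>, and all three have the same norm, so they coincide.\<close>

lemma sphere_convex_combination:
  fixes x y z :: "nat \<Rightarrow> nat"
  assumes k: "2 \<le> k" and eq: "\<And>i. i < d \<Longrightarrow> x i + (k - 1) * y i = k * z i"
    and norm: "(\<Sum>i<d. (x i)\<^sup>2) = s" "(\<Sum>i<d. (y i)\<^sup>2) = s" "(\<Sum>i<d. (z i)\<^sup>2) = s"
    and "i < d"
  shows "x i = y i \<and> z i = y i"
proof -
  define K where "K = int k"
  have eq': "int (x i) + (K - 1) * int (y i) = K * int (z i)" if "i < d" for i
    using arg_cong[OF eq[OF that], of int] k by (simp add: K_def of_nat_diff)
  have norm': "(\<Sum>i<d. (int (x i))\<^sup>2) = int s" "(\<Sum>i<d. (int (y i))\<^sup>2) = int s" "(\<Sum>i<d. (int (z i))\<^sup>2) = int s"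
    using norm[THEN arg_cong[of _ _ int]] by simp_all
  \<comment> \<open>The identity is
    \<open>(K-1)|x-y|^2 = K|x|^2 + K(K-1)|y|^2 - |x+(K-1)y|^2\<close>; for equal norms its right
    side vanishes. Integers are used because of the subtractions.\<close>
  have "(K - 1) * (\<Sum>i<d. (int (x i) - int (y i))\<^sup>2)
      = (\<Sum>i<d. K * (int (x i))\<^sup>2 + K * (K - 1) * (int (y i))\<^sup>2 - K\<^sup>2 * (int (z i))\<^sup>2)"
    unfolding sum_distrib_left
  proof (rule sum.cong[OF refl])
    fix i assume "i \<in> {..<d}"
    then have "K\<^sup>2 * (int (z i))\<^sup>2 = (int (x i) + (K - 1) * int (y i))\<^sup>2"
      using eq'[of i] by (simp add: power_mult_distrib)
    then show "(K - 1) * (int (x i) - int (y i))\<^sup>2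
        = K * (int (x i))\<^sup>2 + K * (K - 1) * (int (y i))\<^sup>2 - K\<^sup>2 * (int (z i))\<^sup>2"
      by (simp add: power2_eq_square algebra_simps)
  qed
  also have "\<dots> = K * int s + K * (K - 1) * int s - K\<^sup>2 * int s"
    unfolding sum_subtractf sum.distrib sum_distrib_left[symmetric] norm' ..
  also have "\<dots> = 0" by algebra
  finally have "(\<Sum>i<d. (int (x i) - int (y i))\<^sup>2) = 0" using k by (simp add: K_def)
  then have "(int (x i) - int (y i))\<^sup>2 = 0" using \<open>i < d\<close> by (subst (asm) sum_nonneg_eq_0_iff) auto
  then have xy: "x i = y i" by simp
  have "k * y i = k * z i"
    using eq[OF \<open>i < d\<close>] xy k by (metis add_mult_distrib le_add_diff_inverse mult_1 one_le_numeral order.trans)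
  with xy k show ?thesis by simp
qed

text \<open>Behrend's construction: the points of the cube with side \<open>D\<close> on a most
  popular sphere, read as digits in base \<open>t * D\<close>. For \<open>k \<le> t\<close> both
  sides of the equation have digits below the base, so there are no carries and the equation holds
  in every coordinate, where \<open>sphere_convex_combination\<close> applies.\<close>

lemma behrend_set:
  assumes t: "1 \<le> t" and D: "1 \<le> D" and d: "1 \<le> d"
  shows "\<exists>A. A \<subseteq> {..<(t * D) ^ d} \<and> D ^ d \<le> d * D\<^sup>2 * card A \<and>
    (\<forall>k a b c. 2 \<le> k \<longrightarrow> k \<le> t \<longrightarrow> a \<in> A \<longrightarrow> b \<in> A \<longrightarrow> c \<in> A \<longrightarrow> a + (k - 1) * b = k * c \<longrightarrow> a = b \<and> c = b)"
proof -
  define B where "B = t * D"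
  define X where "X = {..<d} \<rightarrow>\<^sub>E {..<D}"
  \<comment> \<open>Every squared norm on the cube is below \<open>N\<close>, so the pigeonhole
    principle runs over \<open>N\<close> spheres.\<close>
  define N where "N = d * D\<^sup>2"
  define f where "f s = {x \<in> X. (\<Sum>i<d. (x i)\<^sup>2) = s}" for s
  have finX: "finite X" by (auto simp: X_def intro: finite_PiE)
  have cardX: "card X = D ^ d" by (simp add: X_def card_PiE)
  have XD: "x i < D" if "x \<in> X" "i < d" for x i using that by (auto simp: X_def PiE_iff)
  have DB: "D \<le> B" using t by (simp add: B_def)
  have "\<exists>s. card X \<le> N * card (f s)"
  proof (rule ccontr)
    assume "\<not> ?thesis"
    then have lt: "N * card (f s) < card X" for s by (simp add: not_le)
    have N: "0 < N" using d D by (simp add: N_def)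
    have "X \<subseteq> (\<Union>s<N. f s)"
    proof
      fix x assume x: "x \<in> X"
      have "(\<Sum>i<d. (x i)\<^sup>2) < (\<Sum>i<d. D\<^sup>2)"
        using XD[OF x] d by (intro sum_strict_mono power_strict_mono) (auto simp: lessThan_empty_iff)
      then show "x \<in> (\<Union>s<N. f s)" using x by (simp add: N_def f_def)
    qed
    then have "card X \<le> card (\<Union>s<N. f s)" using finX by (intro card_mono) (auto simp: f_def)
    also have "\<dots> \<le> (\<Sum>s<N. card (f s))" by (rule card_UN_le) simp
    finally have "N * card X \<le> (\<Sum>s<N. N * card (f s))" by (simp flip: sum_distrib_left)
    also have "\<dots> < (\<Sum>s<N. card X)" using lt N by (intro sum_strict_mono) auto
    finally show False by simp
  qed
  then obtain s where s: "D ^ d \<le> N * card (f s)" by (auto simp: cardX)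
  define A where "A = base_value B d ` f s"
  have inj: "inj_on (base_value B d) X"
  proof (rule inj_onI)
    fix x y assume xy: "x \<in> X" "y \<in> X" "base_value B d x = base_value B d y"
    have "x i = y i" if "i < d" for i
      using XD[OF xy(1)] XD[OF xy(2)] DB that by (intro base_value_inject[OF xy(3)]) (auto intro: less_le_trans)
    then show "x = y" using xy(1,2) by (intro PiE_ext[of x "{..<d}" "\<lambda>_. {..<D}" y]) (auto simp: X_def)
  qed
  have "card A = card (f s)"
    unfolding A_def by (rule card_image) (rule inj_on_subset[OF inj], auto simp: f_def)
  then have "D ^ d \<le> d * D\<^sup>2 * card A" using s by (simp add: N_def)
  moreover have "A \<subseteq> {..<(t * D) ^ d}"
    unfolding A_def B_def[symmetric]
    using XD DB by (auto simp: f_def intro!: base_value_less intro: less_le_trans)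
  moreover have "a = b \<and> c = b"
    if k: "2 \<le> k" "k \<le> t" and abc: "a \<in> A" "b \<in> A" "c \<in> A" and eq: "a + (k - 1) * b = k * c" for k a b c
  proof -
    obtain x y z where xyz: "x \<in> f s" "y \<in> f s" "z \<in> f s"
      and v: "a = base_value B d x" "b = base_value B d y" "c = base_value B d z"
      using abc by (auto simp: A_def)
    have less: "x i < D" "y i < D" "z i < D" if "i < d" for i using xyz XD that by (auto simp: f_def)
    have kD: "k * D \<le> B" using k by (simp add: B_def)
    have eq': "base_value B d (\<lambda>i. x i + (k - 1) * y i) = base_value B d (\<lambda>i. k * z i)"
      using eq unfolding v base_value_def by (simp add: sum.distrib sum_distrib_left algebra_simps)
    have dig: "x i + (k - 1) * y i = k * z i" if "i < d" for i
    proof (rule base_value_inject[OF eq' _ _ that])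
      fix i assume i: "i < d"
      have "x i + (k - 1) * y i < D + (k - 1) * D"
        using less[OF i] by (intro add_less_le_mono mult_le_mono2) auto
      also have "\<dots> = k * D" using k by (cases k) auto
      finally show "x i + (k - 1) * y i < B" using kD by simp
      have "k * z i < k * D" using less[OF i] k by simp
      then show "k * z i < B" using kD by (rule less_le_trans)
    qed
    have "x i = y i \<and> z i = y i" if "i < d" for i
      using xyz that by (intro sphere_convex_combination[OF k(1) dig]) (auto simp: f_def)
    then show ?thesis unfolding v base_value_def by auto
  qed
  ultimately show ?thesis by (intro exI[of _ A]) blast
qed

section \<open>Grid cliques and their colouring\<close>

text \<open>The \<open>t\<close> classes are interleaved in one vertex set: the residue modulo
  \<open>t\<close> is the class, the quotient is the integer \<open>x + i * y\<close> inside class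
  \<open>i\<close>.\<close>

definition grid_point :: "nat \<Rightarrow> nat \<Rightarrow> nat \<Rightarrow> nat \<Rightarrow> nat" where
  "grid_point t x y i = i + t * (x + i * y)"

lemma grid_point_mod [simp]: "i < t \<Longrightarrow> grid_point t x y i mod t = i"
  by (simp add: grid_point_def)

lemma grid_point_div [simp]: "i < t \<Longrightarrow> grid_point t x y i div t = x + i * y"
  by (simp add: grid_point_def)

definition grid_clique :: "nat \<Rightarrow> nat \<Rightarrow> nat \<Rightarrow> nat set" where
  "grid_clique t x y = grid_point t x y ` {..<t}"

lemma inj_mod_grid_clique: "inj_on (\<lambda>u. u mod t) (grid_clique t x y)"
  by (auto simp: grid_clique_def intro!: inj_onI)

lemma card_grid_clique: "card (grid_clique t x y) = t"
proof -
  have "inj_on (grid_point t x y) {..<t}"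
    by (rule inj_onI) (metis grid_point_mod lessThan_iff)
  then show ?thesis by (simp add: grid_clique_def card_image)
qed

text \<open>Residues reveal the two indices, and an arithmetic progression is determined by its
  values at two different indices.\<close>

lemma grid_clique_determined:
  assumes "u \<in> grid_clique t x y" "u \<in> grid_clique t x' y'" "w \<in> grid_clique t x y" "w \<in> grid_clique t x' y'" "u \<noteq> w"
  shows "x = x' \<and> y = y'"
proof -
  obtain i i' j j' where *: "i < t" "i' < t" "j < t" "j' < t"
    "u = grid_point t x y i" "u = grid_point t x' y' i'" "w = grid_point t x y j" "w = grid_point t x' y' j'"
    using assms by (auto simp: grid_clique_def)
  have [simp]: "i' = i" "j' = j" using * by (metis grid_point_mod)+
  have "i \<noteq> j" using * assms(5) by auto
  have e: "x + i * y = x' + i * y'" "x + j * y = x' + j * y'"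
    using * by (metis grid_point_div \<open>i' = i\<close>, metis grid_point_div \<open>j' = j\<close>)
  have "int x + int i * int y = int x' + int i * int y'" "int x + int j * int y = int x' + int j * int y'"
    using arg_cong[OF e(1), of int] arg_cong[OF e(2), of int] by auto
  then have "(int i - int j) * (int y - int y') = 0" by algebra
  then have "y = y'" using \<open>i \<noteq> j\<close> by simp
  then show ?thesis using e by simp
qed

lemma card_edges_of: "finite S \<Longrightarrow> card (edges_of S) = card S choose 2"
  unfolding edges_of_def by (rule n_subsets)

text \<open>There are as many labels as edges in a \<open>t\<close>-clique, so a rainbow clique
  shows every label. Hence rainbow cliques are grid cliques, and two of those sharing an edge are
  equal.\<close>

lemma grid_colouring:
  assumes t: "4 \<le> t" and A: "A \<subseteq> {..<N}"
    and free: "\<forall>k a b c. 2 \<le> k \<longrightarrow> k \<le> t \<longrightarrow> a \<in> A \<longrightarrow> b \<in> A \<longrightarrow> c \<in> A \<longrightarrow> a + (k - 1) * b = k * c \<longrightarrow> a = b \<and> c = b"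
    and n: "t * t * N \<le> n"
  shows "\<exists>c. almost_gallai t n c \<and> card (c ` Kn_edges n) \<le> t choose 2 \<and> N * card A \<le> card (rainbow_cliques t n c)"
proof -
  define G where "G = (\<Union>x<N. \<Union>y\<in>A. edges_of (grid_clique t x y))"
  \<comment> \<open>The default \<open>{2, 3}\<close> is a pair of classes since
    \<open>t \<ge> 4\<close>, and no triangle on the classes 0, 1, \<open>k\<close> contains
    it.\<close>
  define label where "label e = (if e \<in> G then (\<lambda>u. u mod t) ` e else {2, 3})" for e
  \<comment> \<open>Labels become natural numbers through an encoding that is injective on finite
    sets.\<close>
  define c where "c e = set_encode (label e)" for e
  define P where "P = edges_of {..<t}"
  have finP: "finite P" by (simp add: P_def finite_edges_of)
  have cardP: "card P = t choose 2" by (simp add: P_def card_edges_of)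
  have lab: "label e \<in> P" for e
  proof (cases "e \<in> G")
    case True
    then obtain x y where e: "e \<in> edges_of (grid_clique t x y)" by (auto simp: G_def)
    then have "card ((\<lambda>u. u mod t) ` e) = 2"
      using inj_on_subset[OF inj_mod_grid_clique] by (subst card_image) (auto simp: edges_of_def)
    moreover have "(\<lambda>u. u mod t) ` e \<subseteq> {..<t}" using t by auto
    ultimately show ?thesis using True by (simp add: label_def P_def edges_of_def)
  next
    case False
    then show ?thesis using t by (simp add: label_def P_def doubleton_in_edges_of_iff)
  qed
  have labfin: "finite (label e)" for e using lab[of e] by (auto simp: P_def edges_of_def intro: finite_subset)
  have c_eq: "c e = c e' \<longleftrightarrow> label e = label e'" for e e'
    using labfin by (auto simp: c_def dest: set_encode_eq[THEN iffD1, rotated 2])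
  \<comment> \<open>Away from the default pair, the edge carrying a given label lies in some grid
    clique, whose parameters may at first depend on the label.\<close>
  have pair: "\<exists>u w x y. u \<in> S \<and> w \<in> S \<and> x < N \<and> y \<in> A \<and> u = grid_point t x y i \<and> w = grid_point t x y j"
    if S: "rainbow_clique t n c S" and ij: "i < j" "j < t" "{i, j} \<noteq> {2, 3}" for S i j
  proof -
    have SP: "card S = t" "finite S" "inj_on c (edges_of S)"
      using S by (auto simp: rainbow_clique_def intro: finite_subset)
    have "inj_on label (edges_of S)" using SP(3) by (auto simp: inj_on_def c_eq)
    then have "card (label ` edges_of S) = card P" using SP by (simp add: card_image card_edges_of cardP)
    then have "label ` edges_of S = P" using lab finP by (intro card_subset_eq) auto
    moreover have "{i, j} \<in> P" using ij by (simp add: P_def doubleton_in_edges_of_iff)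
    ultimately obtain e where e: "e \<in> edges_of S" "label e = {i, j}" by (metis imageE)
    then have eG: "e \<in> G" "(\<lambda>u. u mod t) ` e = {i, j}" using ij by (auto simp: label_def split: if_splits)
    then obtain x y where xy: "x < N" "y \<in> A" "e \<in> edges_of (grid_clique t x y)" by (auto simp: G_def)
    have pt: "grid_point t x y a \<in> S" if "a \<in> {i, j}" for a
    proof -
      have "a \<in> (\<lambda>u. u mod t) ` e" using that eG(2) by simp
      then obtain u where u: "u \<in> e" "a = u mod t" by auto
      moreover have "u \<in> grid_clique t x y" "u \<in> S" using u e(1) xy(3) by (auto simp: edges_of_def)
      ultimately show ?thesis by (auto simp: grid_clique_def)
    qed
    show ?thesis using pt[of i] pt[of j] xy by blast
  qed
  have classify: "\<exists>x y. x < N \<and> y \<in> A \<and> S = grid_clique t x y" if S: "rainbow_clique t n c S" for S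
  proof -
    have SP: "card S = t" "finite S" using S by (auto simp: rainbow_clique_def intro: finite_subset)
    \<comment> \<open>Every class is seen through a pair involving class 0, never the default pair;
      so the \<open>t\<close> vertices of \<open>S\<close> occupy the \<open>t\<close> classes once
      each.\<close>
    have "{..<t} \<subseteq> (\<lambda>u. u mod t) ` S"
    proof
      fix i assume "i \<in> {..<t}"
      then have i: "i < t" by simp
      show "i \<in> (\<lambda>u. u mod t) ` S"
      proof (cases "i = 0")
        case True
        then obtain u x y where "u \<in> S" "u = grid_point t x y i"
          using pair[OF S, of 0 1] t by (auto simp: doubleton_eq_iff)
        then show ?thesis using i by (intro image_eqI[of _ _ u]) auto
      next
        case False
        then obtain w x y where "w \<in> S" "w = grid_point t x y i"
          using pair[OF S, of 0 i] i by (auto simp: doubleton_eq_iff)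
        then show ?thesis using i by (intro image_eqI[of _ _ w]) auto
      qed
    qed
    then have "card {..<t} \<le> card ((\<lambda>u. u mod t) ` S)" using SP by (intro card_mono) auto
    then have inj: "inj_on (\<lambda>u. u mod t) S"
      using SP card_image_le[OF SP(2), of "\<lambda>u. u mod t"] by (intro eq_card_imp_inj_on) auto
    have uniq: "x + i * y = x' + i * y'"
      if "grid_point t x y i \<in> S" "grid_point t x' y' i \<in> S" "i < t" for x y x' y' i
      using inj_onD[OF inj, of "grid_point t x y i" "grid_point t x' y' i"] that by (metis grid_point_div grid_point_mod)
    \<comment> \<open>The edge between classes 0 and 1 fixes the grid clique; the other vertices of
      \<open>S\<close> are then shown to be those of this clique.\<close>
    obtain x p where xp: "x < N" "p \<in> A" "grid_point t x p 0 \<in> S" "grid_point t x p 1 \<in> S"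
      using pair[OF S, of 0 1] t by (auto simp: doubleton_eq_iff)
    have "grid_point t x p k \<in> S" if "k < t" for k
    proof -
      consider "k = 0" | "k = 1" | "2 \<le> k" by linarith
      then show ?thesis
      proof cases
        case 3
        obtain x1 r where r: "r \<in> A" "grid_point t x1 r 0 \<in> S" "grid_point t x1 r k \<in> S"
          using pair[OF S, of 0 k] \<open>k < t\<close> 3 by (auto simp: doubleton_eq_iff)
        obtain x2 q where q: "q \<in> A" "grid_point t x2 q 1 \<in> S" "grid_point t x2 q k \<in> S"
          using pair[OF S, of 1 k] \<open>k < t\<close> 3 by (auto simp: doubleton_eq_iff)
        \<comment> \<open>The three progressions agree at their common vertices in classes 0, 1 and
          \<open>k\<close>; eliminating the starting points leaves
          \<open>p + (k - 1) * q = k * r\<close>.\<close>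
        have e: "x = x1" "x + p = x2 + q" "x1 + k * r = x2 + k * q"
          using uniq[OF xp(3) r(2)] uniq[OF xp(4) q(2)] uniq[OF r(3) q(3)] \<open>k < t\<close> t by auto
        obtain m where m: "k = Suc m" using 3 by (cases k) auto
        have "p + (k - 1) * q = k * r" using e unfolding m by (simp add: algebra_simps)
        then have "p = q \<and> r = q" using free[rule_format, of k p q r] 3 \<open>k < t\<close> xp r q by simp
        then show ?thesis using e r by simp
      qed (use xp in auto)
    qed
    then have "grid_clique t x p \<subseteq> S" by (auto simp: grid_clique_def)
    then have "grid_clique t x p = S" using SP by (intro card_subset_eq) (auto simp: card_grid_clique)
    then show ?thesis using xp by blast
  qed
  have ag: "almost_gallai t n c"
    unfolding almost_gallai_def
  proof (intro allI impI notI)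
    fix S T assume ST: "rainbow_clique t n c S \<and> rainbow_clique t n c T \<and> S \<noteq> T"
      and "\<exists>e. e \<in> edges_of S \<and> e \<in> edges_of T"
    then obtain e where e: "e \<in> edges_of S" "e \<in> edges_of T" by blast
    then obtain u w where "e = {u, w}" "u \<noteq> w" by (auto simp: edges_of_def card_2_iff)
    then have uw: "u \<in> S" "w \<in> S" "u \<in> T" "w \<in> T" "u \<noteq> w" using e by (auto simp: edges_of_def)
    obtain x y x' y' where "S = grid_clique t x y" "T = grid_clique t x' y'"
      using classify ST by meson
    with uw ST show False using grid_clique_determined[of u t x y x' y' w] by auto
  qed
  have rainbow: "grid_clique t x y \<in> rainbow_cliques t n c" if xy: "x < N" "y \<in> A" for x y
  proof -
    have "grid_point t x y i < n" if "i < t" for i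
    proof -
      have N: "x \<le> N - 1" "y \<le> N - 1" "1 \<le> N" using xy A by auto
      \<comment> \<open>The extreme values \<open>x = y = N - 1\<close> and \<open>i = t - 1\<close>
        still give a vertex below \<open>t * t * N\<close>.\<close>
      have "x + i * y \<le> (N - 1) + (t - 1) * (N - 1)" using N that by (intro add_mono mult_le_mono) auto
      also have "\<dots> = t * (N - 1)" using t by (cases t) auto
      finally have "t * (x + i * y) \<le> t * (t * (N - 1))" by (rule mult_le_mono2)
      then have "grid_point t x y i < t + t * (t * (N - 1))" using that unfolding grid_point_def by linarith
      also have "\<dots> \<le> t * t + t * t * (N - 1)" using t by simp
      also have "\<dots> = t * t * N" using N by (cases N) auto
      finally show ?thesis using n by simp
    qed
    then have "grid_clique t x y \<subseteq> {..<n}" by (auto simp: grid_clique_def)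
    moreover have "inj_on c (edges_of (grid_clique t x y))"
    proof (rule inj_onI)
      fix e e' assume e: "e \<in> edges_of (grid_clique t x y)" "e' \<in> edges_of (grid_clique t x y)" "c e = c e'"
      then have "e \<in> G" "e' \<in> G" using xy by (auto simp: G_def)
      then have "(\<lambda>u. u mod t) ` e = (\<lambda>u. u mod t) ` e'" using e(3) by (simp add: c_eq label_def)
      then show "e = e'"
        using inj_on_image_eq_iff[OF inj_mod_grid_clique, of e t x y e'] e(1,2) by (auto simp: edges_of_def)
    qed
    ultimately show ?thesis by (simp add: rainbow_cliques_def rainbow_clique_def card_grid_clique)
  qed
  have "inj_on (\<lambda>(x, y). grid_clique t x y) ({..<N} \<times> A)"
  proof (rule inj_onI, clarify)
    fix x y x' y' assume eq: "grid_clique t x y = grid_clique t x' y'"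
    have "grid_point t x y 0 \<in> grid_clique t x y" "grid_point t x y 1 \<in> grid_clique t x y"
      using t by (auto simp: grid_clique_def)
    moreover have "grid_point t x y 0 \<noteq> grid_point t x y 1"
      using t by (metis grid_point_mod less_le_trans one_less_numeral_iff semiring_norm(76) zero_less_numeral zero_neq_one)
    ultimately show "x = x' \<and> y = y'" using grid_clique_determined eq by metis
  qed
  then have "card ({..<N} \<times> A) \<le> card (rainbow_cliques t n c)"
    by (rule card_inj_on_le) (use rainbow finite_rainbow_cliques in auto)
  then have "N * card A \<le> card (rainbow_cliques t n c)" by (simp add: card_cartesian_product)
  moreover have "card (c ` Kn_edges n) \<le> t choose 2"
  proof -
    have "c ` Kn_edges n \<subseteq> set_encode ` P" using lab by (auto simp: c_def)
    then have "card (c ` Kn_edges n) \<le> card (set_encode ` P)" using finP by (intro card_mono) auto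
    also have "\<dots> \<le> t choose 2" using card_image_le[OF finP] cardP by simp
    finally show ?thesis .
  qed
  ultimately show ?thesis using ag by blast
qed

section \<open>Choice of parameters and the vanishing exponent\<close>

text \<open>The Behrend set loses a factor \<open>d * D^2\<close>, and \<open>D^2\<close> is at most
  \<open>n powr (2 / d)\<close>. A fixed dimension with \<open>2 / d < e\<close> therefore suffices,
  and the surplus \<open>s\<close> in the exponent absorbs all constants.\<close>

lemma near_quadratic_colouring:
  assumes t: "4 \<le> t" and e: "0 < e"
  shows "\<forall>\<^sub>F n in sequentially. \<exists>c. almost_gallai t n c \<and> card (c ` Kn_edges n) \<le> t choose 2 \<and>
    real n powr (2 - e) \<le> real (card (rainbow_cliques t n c))"
proof -
  obtain d :: nat where "2 / e < real d" using reals_Archimedean2 by blast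
  then have d: "1 \<le> d" "2 / real d < e"
    using e by (cases d; simp add: field_simps)+
  \<comment> \<open>\<open>\<gamma>\<close> bounds the ratio of \<open>n\<close> to
    \<open>D ^ d\<close>; \<open>\<kappa>\<close> collects the constants of the final
    estimate.\<close>
  define \<gamma> where "\<gamma> = real (t * t) * real (2 * t) ^ d"
  define \<kappa> where "\<kappa> = \<gamma>\<^sup>2 * real d"
  have \<gamma>: "0 < \<gamma>" using t by (simp add: \<gamma>_def)
  have \<kappa>: "0 < \<kappa>" using \<gamma> d by (simp add: \<kappa>_def)
  define s where "s = e - 2 / real d"
  have s: "0 < s" using d by (simp add: s_def)
  have "\<forall>\<^sub>F n in sequentially. nat \<lceil>\<kappa> powr (1 / s)\<rceil> \<le> n" by (rule eventually_ge_at_top)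
  then have "\<forall>\<^sub>F n in sequentially. \<kappa> \<le> real n powr s"
  proof eventually_elim
    case (elim n)
    have "\<kappa> = (\<kappa> powr (1 / s)) powr s" using \<kappa> s by (simp add: powr_powr)
    also have "\<dots> \<le> real n powr s" using elim s by (intro powr_mono2) (auto simp: nat_le_iff ceiling_le_iff)
    finally show ?case .
  qed
  \<comment> \<open>Makes side 1 admissible below, so that the largest admissible \<open>D\<close>
    is positive.\<close>
  moreover have "\<forall>\<^sub>F n in sequentially. t * t * t ^ d \<le> n" by (rule eventually_ge_at_top)
  ultimately show ?thesis
  proof eventually_elim
    case (elim n)
    have n: "1 \<le> n" using elim(2) t by (metis One_nat_def Suc_leI le_zero_eq mult_is_0 neq0_conv not_numeral_le_zero power_not_zero)
    \<comment> \<open>\<open>Q m\<close> says that the grid of side \<open>m\<close> does not fit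
      into \<open>n\<close> vertices. \<open>D\<close> is the last value before the first failure,
      which exists because \<open>Q n\<close> holds.\<close>
    define Q where "Q m \<longleftrightarrow> n < t * t * (t * m) ^ d" for m
    have "n \<le> n ^ d" using n d by (simp add: self_le_power)
    also have "\<dots> < t * t * (t * n) ^ d"
    proof -
      have "n ^ d < 2 * n ^ d" using n by simp
      also have "\<dots> \<le> t * t * (t * n) ^ d"
        using t by (intro mult_mono power_mono) (auto intro: order.trans[of _ "4 * 4"] mult_mono)
      finally show ?thesis .
    qed
    finally have "Q n" by (simp add: Q_def)
    moreover have "\<not> Q 0" using d(1) by (cases d) (auto simp: Q_def)
    ultimately obtain D where D: "\<forall>i\<le>D. \<not> Q i" "Q (Suc D)" using ex_least_nat_less[of Q n] by blast
    have "\<not> Q 1" using elim(2) by (simp add: Q_def)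
    then have D1: "1 \<le> D" using D(2) by (cases D) auto
    define N where "N = (t * D) ^ d"
    have N: "t * t * N \<le> n" using D(1) by (auto simp: Q_def N_def not_less)
    obtain A where A: "A \<subseteq> {..<N}" "D ^ d \<le> d * D\<^sup>2 * card A"
      and free: "\<forall>k a b c. 2 \<le> k \<longrightarrow> k \<le> t \<longrightarrow> a \<in> A \<longrightarrow> b \<in> A \<longrightarrow> c \<in> A \<longrightarrow> a + (k - 1) * b = k * c \<longrightarrow> a = b \<and> c = b"
      using behrend_set[OF _ D1 d(1), of t] t unfolding N_def by auto
    obtain c where c: "almost_gallai t n c" "card (c ` Kn_edges n) \<le> t choose 2" "N * card A \<le> card (rainbow_cliques t n c)"
      using grid_colouring[OF t A(1) free N] by blast
    define x where "x = real D ^ d"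
    have x: "0 < x" using D1 by (simp add: x_def)
    have "n < t * t * (t * Suc D) ^ d" using D(2) by (simp add: Q_def)
    \<comment> \<open>Replacing \<open>Suc D\<close> by \<open>2 * D\<close> costs the factor
      \<open>2 ^ d\<close> contained in \<open>\<gamma>\<close>.\<close>
    also have "\<dots> \<le> t * t * (2 * t * D) ^ d" using D1 by (intro mult_le_mono2 power_mono) auto
    finally have "real n < real (t * t * (2 * t * D) ^ d)" by (rule of_nat_less_iff[THEN iffD2])
    then have nx: "real n \<le> \<gamma> * x" by (simp add: \<gamma>_def x_def power_mult_distrib mult_ac)
    have D_le: "D ^ d \<le> N" using t by (simp add: N_def power_mult_distrib)
    have "1 * N \<le> t * t * N" using t by (intro mult_le_mono1) simp
    then have "D ^ d \<le> n" using N D_le by linarith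
    then have xn: "x \<le> real n" by (metis of_nat_le_iff of_nat_power x_def)
    have "x = real D powr real d" using D1 by (simp add: x_def powr_realpow)
    then have "(real D)\<^sup>2 = x powr (2 / real d)" using D1 d by (simp add: powr_powr)
    also have "\<dots> \<le> real n powr (2 / real d)" using x xn by (intro powr_mono2) auto
    finally have D2: "(real D)\<^sup>2 \<le> real n powr (2 / real d)" .
    let ?C = "real (card (rainbow_cliques t n c))"
    have "real (D ^ d) \<le> real (d * D\<^sup>2 * card A)" using A(2) by (rule of_nat_mono)
    then have xA: "x \<le> real d * (real D)\<^sup>2 * real (card A)" by (simp add: x_def)
    have "real (N * card A) \<le> ?C" using c(3) by (rule of_nat_mono)
    moreover have "x \<le> real N" using of_nat_mono[OF D_le, where 'a = real] by (simp add: x_def)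
    ultimately have "x * real (card A) \<le> ?C" by (smt (verit) mult_right_mono of_nat_0_le_iff of_nat_mult)
    then have "real d * (real D)\<^sup>2 * (x * real (card A)) \<le> real d * (real D)\<^sup>2 * ?C"
      by (intro mult_left_mono) auto
    moreover have "x * x \<le> x * (real d * (real D)\<^sup>2 * real (card A))" using xA x by (intro mult_left_mono) auto
    \<comment> \<open>Combines at least \<open>x * card A\<close> cliques with the Behrend bound of
      \<open>x / (d * D^2)\<close> for \<open>card A\<close>.\<close>
    ultimately have "x\<^sup>2 \<le> real d * (real D)\<^sup>2 * ?C" by (simp add: power2_eq_square mult_ac)
    also have "\<dots> \<le> real d * real n powr (2 / real d) * ?C" using D2 by (intro mult_right_mono mult_left_mono) auto
    finally have xC: "x\<^sup>2 \<le> real d * real n powr (2 / real d) * ?C" .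
    have "(real n)\<^sup>2 \<le> (\<gamma> * x)\<^sup>2" using nx by (intro power_mono) auto
    also have "\<dots> \<le> \<gamma>\<^sup>2 * (real d * real n powr (2 / real d) * ?C)"
      unfolding power_mult_distrib using xC by (intro mult_left_mono) auto
    also have "\<dots> = \<kappa> * real n powr (2 / real d) * ?C" by (simp add: \<kappa>_def mult_ac)
    also have "\<dots> \<le> real n powr s * real n powr (2 / real d) * ?C"
      using elim(1) by (intro mult_right_mono) auto
    also have "\<dots> = real n powr e * ?C" by (simp add: s_def flip: powr_add)
    finally have "(real n)\<^sup>2 \<le> real n powr e * ?C" .
    moreover have "(real n)\<^sup>2 = real n powr e * real n powr (2 - e)"
      using n by (simp flip: powr_add powr_numeral)
    ultimately have "real n powr (2 - e) \<le> ?C" using n by simp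
    then show ?case using c by blast
  qed
qed

text \<open>A single exponent function is read off from the best count with few colours, which
  avoids a diagonal argument; its convergence follows from the bounds for each fixed
  \<open>e\<close>.\<close>

lemma near_quadratic_exponent:
  assumes t: "4 \<le> t"
  shows "\<exists>\<epsilon> :: nat \<Rightarrow> real. \<epsilon> \<longlonglongrightarrow> 0 \<and> (\<forall>\<^sub>F n in sequentially.
     \<exists>c. almost_gallai t n c \<and> card (c ` Kn_edges n) \<le> t choose 2 \<and>
       real n powr (2 - \<epsilon> n) \<le> real (card (rainbow_cliques t n c)))"
proof -
  define counts where "counts n = {k. \<exists>c. almost_gallai t n c \<and> card (c ` Kn_edges n) \<le> t choose 2 \<and>
      card (rainbow_cliques t n c) = k}" for n
  define best where "best n = Max (counts n)" for n
  \<comment> \<open>\<open>2 - \<epsilon> n\<close> is at most the base-\<open>n\<close> logarithm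
    of the best count. With the cut at 0, convergence needs only upper estimates.\<close>
  define \<epsilon> where "\<epsilon> n = max 0 (2 - ln (real (best n)) / ln (real n))" for n
  have fin: "finite (counts n)" for n
    by (rule finite_subset[OF _ finite_clique_counts[of t n]]) (auto simp: counts_def)
  have lower: "\<forall>\<^sub>F n in sequentially. best n \<in> counts n \<and> real n powr (2 - e) \<le> real (best n) \<and> 2 \<le> n"
    if "0 < e" for e
    using near_quadratic_colouring[OF t that] eventually_ge_at_top[of 2]
  proof eventually_elim
    case (elim n)
    then obtain c where c: "card (rainbow_cliques t n c) \<in> counts n"
      "real n powr (2 - e) \<le> real (card (rainbow_cliques t n c))" by (auto simp: counts_def)
    have "best n \<in> counts n" unfolding best_def using Max_in[OF fin] c(1) by blast
    moreover have "card (rainbow_cliques t n c) \<le> best n" unfolding best_def by (rule Max_ge[OF fin c(1)])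
    ultimately show ?case using c(2) elim by linarith
  qed
  have "\<epsilon> \<longlonglongrightarrow> 0"
  proof (rule tendstoI)
    fix r :: real assume r: "0 < r"
    show "\<forall>\<^sub>F n in sequentially. dist (\<epsilon> n) 0 < r"
      using lower[OF half_gt_zero[OF r]]
    proof eventually_elim
      case (elim n)
      then have "ln (real n powr (2 - r / 2)) \<le> ln (real (best n))" by (intro ln_mono) auto
      then have "(2 - r / 2) * ln (real n) \<le> ln (real (best n))" using elim by (simp add: ln_powr)
      then have "2 - r / 2 \<le> ln (real (best n)) / ln (real n)" using elim by (simp add: le_divide_eq)
      then show ?case using r by (simp add: \<epsilon>_def)
    qed
  qed
  moreover have "\<forall>\<^sub>F n in sequentially. \<exists>c. almost_gallai t n c \<and> card (c ` Kn_edges n) \<le> t choose 2 \<and>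
       real n powr (2 - \<epsilon> n) \<le> real (card (rainbow_cliques t n c))"
    \<comment> \<open>The instance \<open>e = 1\<close> makes \<open>best n\<close> positive, so
      that its logarithm can be exponentiated back.\<close>
    using lower[of 1, simplified]
  proof eventually_elim
    case (elim n)
    then have best: "0 < real (best n)" by linarith
    have "2 - \<epsilon> n \<le> ln (real (best n)) / ln (real n)" by (simp add: \<epsilon>_def)
    then have "real n powr (2 - \<epsilon> n) \<le> real n powr (ln (real (best n)) / ln (real n))"
      using elim by (intro powr_mono) auto
    also have "\<dots> = real (best n)" using elim best by (simp add: powr_def)
    finally show ?case using elim by (auto simp: counts_def)
  qed
  ultimately show ?thesis by blast
qed

theorem theorem1p1:
  shows "(\<forall>t\<ge>3. ((\<lambda>n. real (tau t n) / (real n) ^ 2) \<longlongrightarrow> 0) sequentially)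
       \<and> (\<forall>t\<ge>4. \<exists>\<epsilon> :: nat \<Rightarrow> real. (\<epsilon> \<longlongrightarrow> 0) sequentially \<and>
            (\<forall>\<^sub>F n in sequentially.
               real (tau t n) \<ge> real n powr (2 - \<epsilon> n) \<and>
               (\<exists>c. almost_gallai t n c \<and> card (c ` Kn_edges n) \<le> t choose 2 \<and>
                    real (card (rainbow_cliques t n c)) \<ge> real n powr (2 - \<epsilon> n))))"
proof (intro conjI allI impI)
  show "(\<lambda>n. real (tau t n) / (real n) ^ 2) \<longlonglongrightarrow> 0" if "3 \<le> t" for t
    using that by (rule tau_subquadratic)
next
  fix t :: nat assume "4 \<le> t"
  from near_quadratic_exponent[OF this] obtain \<epsilon> :: "nat \<Rightarrow> real" where "\<epsilon> \<longlonglongrightarrow> 0"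
    and ev: "\<forall>\<^sub>F n in sequentially. \<exists>c. almost_gallai t n c \<and> card (c ` Kn_edges n) \<le> t choose 2 \<and>
       real n powr (2 - \<epsilon> n) \<le> real (card (rainbow_cliques t n c))" by blast
  moreover have "\<forall>\<^sub>F n in sequentially. real (tau t n) \<ge> real n powr (2 - \<epsilon> n) \<and>
      (\<exists>c. almost_gallai t n c \<and> card (c ` Kn_edges n) \<le> t choose 2 \<and>
           real (card (rainbow_cliques t n c)) \<ge> real n powr (2 - \<epsilon> n))"
    using ev
  proof eventually_elim
    case (elim n)
    then obtain c where c: "almost_gallai t n c" "real n powr (2 - \<epsilon> n) \<le> real (card (rainbow_cliques t n c))" by blast
    have "real (card (rainbow_cliques t n c)) \<le> real (tau t n)" using le_tau[OF c(1)] by simp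
    with c(2) have "real n powr (2 - \<epsilon> n) \<le> real (tau t n)" by linarith
    then show ?case using elim by blast
  qed
  ultimately show "\<exists>\<epsilon> :: nat \<Rightarrow> real. (\<epsilon> \<longlongrightarrow> 0) sequentially \<and>
            (\<forall>\<^sub>F n in sequentially.
               real (tau t n) \<ge> real n powr (2 - \<epsilon> n) \<and>
               (\<exists>c. almost_gallai t n c \<and> card (c ` Kn_edges n) \<le> t choose 2 \<and>
                    real (card (rainbow_cliques t n c)) \<ge> real n powr (2 - \<epsilon> n)))" by blast
qed

end
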